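(* Let $\Theta,\mathcal X$ be measurable spaces, $P$ a transition probability kernel from $\Theta$ to $\mathcal X$, $\Pi$ a subset of the set $\mathcal P(\Theta)$ of probability measures on $\Theta$, and $T:\Pi\to\mathbb R$ a functional. Suppose that: (A1) the functional $\pi\mapsto T(\pi)$ is affine; (A2) the set $\Pi$ is convex; (A3) there exists a vector space $\mathcal F$ of functions on $\mathcal X$ such that $\mathcal F$ contains constants and is dense in $L_2(\mathcal X,\pi P)$ for every $\pi\in\Pi$; (A4) there exists a topology on $\Pi$ such that (A4a) $\Pi$ is compact, and (A4b) $T(\pi)$, $\pi Pf$ and $\pi P(f^2)$ are continuous in $\pi\in\Pi$ for all $f\in\mathcal F$. Then for every $n\ge 1$, $$\frac{1}{(1+\sqrt e)^2}\,\delta_{\chi^2}\Big(\tfrac1{\sqrt n}\Big)^2\le R^*_{\rm iid}(n)\le \delta_{\chi^2}\Big(\tfrac1{\sqrt n}\Big)^2,$$ where the upper bound can be achieved by an estimator of the form $\hat T=\frac1n\sum_{i=1}^n g(X_i)$ for some $g\in\mathcal F$.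
   Context: For $\pi\in\mathcal P(\Theta)$, $\pi P=\int_\Theta P(\cdot|\theta)\,\pi(d\theta)$ is the induced mixture distribution on $\mathcal X$, and $\pi P f$ denotes the expectation of $f$ under $\pi P$. The minimax quadratic risk is $$R^*_{\rm iid}(n)=\inf_{\hat T}\sup_{\pi\in\Pi}\mathbb E\big[|\hat T(X_1,\dots,X_n)-T(\pi)|^2\big],$$ where $X_1,\dots,X_n$ are i.i.d. with law $\pi P$ and the infimum is over all estimators (measurable functions of the sample). The $\chi^2$-modulus of continuity of $T$ is $$\delta_{\chi^2}(t)=\sup\{T(\pi')-T(\pi):\ \chi^2(\pi'P\|\pi P)\le t^2,\ \pi,\pi'\in\Pi\},$$ where $\chi^2(F\|G)=\int dG\,(dF/dG)^2-1$ if $F\ll G$ and $\chi^2(F\|G)=\infty$ otherwise. *)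

theory Defs
  imports "HOL-Probability.Probability"
begin

text \<open>The convex combination \<open>(1 - l) \<pi> + l \<pi>'\<close> of two measures on the same measurable space.\<close>

definition mixture :: "real \<Rightarrow> 'a measure \<Rightarrow> 'a measure \<Rightarrow> 'a measure" where
  "mixture l \<pi> \<pi>' = measure_of (space \<pi>) (sets \<pi>)
     (\<lambda>A. ennreal (1 - l) * emeasure \<pi> A + ennreal l * emeasure \<pi>' A)"

lemma space_mixture [simp]: "space (mixture l \<pi> \<pi>') = space \<pi>"
  and sets_mixture [simp]: "sets (mixture l \<pi> \<pi>') = sets \<pi>"
  by (simp_all add: mixture_def)

lemma emeasure_mixture:
  assumes "sets \<pi>' = sets \<pi>" "A \<in> sets \<pi>"
  shows "emeasure (mixture l \<pi> \<pi>') A = ennreal (1 - l) * emeasure \<pi> A + ennreal l * emeasure \<pi>' A"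
proof (rule emeasure_measure_of[OF mixture_def])
  show "countably_additive (sets (mixture l \<pi> \<pi>'))
          (\<lambda>A. ennreal (1 - l) * emeasure \<pi> A + ennreal l * emeasure \<pi>' A)"
  proof (rule countably_additiveI)
    fix B :: "nat \<Rightarrow> 'a set"
    assume B: "range B \<subseteq> sets (mixture l \<pi> \<pi>')" "disjoint_family B"
    have "(\<Sum>i. emeasure \<pi> (B i)) = emeasure \<pi> (\<Union>i. B i)"
      and "(\<Sum>i. emeasure \<pi>' (B i)) = emeasure \<pi>' (\<Union>i. B i)"
      using B assms(1) by (auto intro!: suminf_emeasure)
    then show "(\<Sum>i. ennreal (1 - l) * emeasure \<pi> (B i) + ennreal l * emeasure \<pi>' (B i)) =
        ennreal (1 - l) * emeasure \<pi> (\<Union>i. B i) + ennreal l * emeasure \<pi>' (\<Union>i. B i)"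
      by (subst suminf_add[symmetric]) (simp_all only: ennreal_suminf_cmult summableI)
  qed
  show "sets \<pi> \<subseteq> Pow (space \<pi>)"
    by (rule sets.space_closed)
  show "positive (sets (mixture l \<pi> \<pi>'))
          (\<lambda>A. ennreal (1 - l) * emeasure \<pi> A + ennreal l * emeasure \<pi>' A)"
    by (simp add: positive_def)
  show "A \<in> sets (mixture l \<pi> \<pi>')"
    using assms(2) by simp
qed

lemma mixture_in_prob_algebra:
  assumes "\<pi> \<in> space (prob_algebra M)" "\<pi>' \<in> space (prob_algebra M)" "0 \<le> l" "l \<le> 1"
  shows "mixture l \<pi> \<pi>' \<in> space (prob_algebra M)"
proof -
  have s: "sets \<pi> = sets M" "sets \<pi>' = sets M" and p: "prob_space \<pi>" "prob_space \<pi>'"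
    using assms by (auto simp: space_prob_algebra)
  have sp: "space \<pi>' = space \<pi>"
    using s by (metis sets_eq_imp_space_eq)
  have "emeasure \<pi> (space \<pi>) = 1" "emeasure \<pi>' (space \<pi>) = 1"
    using prob_space.emeasure_space_1[OF p(1)] prob_space.emeasure_space_1[OF p(2)] sp by auto
  then have "emeasure (mixture l \<pi> \<pi>') (space \<pi>) = ennreal (1 - l) * 1 + ennreal l * 1"
    using s by (subst emeasure_mixture) auto
  also have "\<dots> = 1"
    using assms by (simp flip: ennreal_plus)
  finally show ?thesis
    using s by (auto simp: space_prob_algebra intro!: prob_spaceI)
qed

definition convex_measures :: "'a measure set \<Rightarrow> bool" where
  "convex_measures Priors \<longleftrightarrow> (\<forall>\<pi>\<in>Priors. \<forall>\<pi>'\<in>Priors. \<forall>l\<in>{0..1}. mixture l \<pi> \<pi>' \<in> Priors)"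

text \<open>The condition is only imposed on convex combinations that stay inside \<open>Priors\<close>.\<close>

definition affine_functional :: "'a measure set \<Rightarrow> ('a measure \<Rightarrow> real) \<Rightarrow> bool" where
  "affine_functional Priors T \<longleftrightarrow>
     (\<forall>\<pi>\<in>Priors. \<forall>\<pi>'\<in>Priors. \<forall>l\<in>{0..1}. mixture l \<pi> \<pi>' \<in> Priors \<longrightarrow>
        T (mixture l \<pi> \<pi>') = (1 - l) * T \<pi> + l * T \<pi>')"

definition function_space :: "('b \<Rightarrow> real) set \<Rightarrow> bool" where
  "function_space F \<longleftrightarrow> (\<lambda>_. 0) \<in> F \<and> (\<forall>f\<in>F. \<forall>g\<in>F. (\<lambda>x. f x + g x) \<in> F) \<and>
     (\<forall>c. \<forall>f\<in>F. (\<lambda>x. c * f x) \<in> F)"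

definition L2 :: "'b measure \<Rightarrow> ('b \<Rightarrow> real) set" where
  "L2 Q = {f \<in> borel_measurable Q. integrable Q (\<lambda>x. (f x)\<^sup>2)}"

definition dense_in_L2 :: "('b \<Rightarrow> real) set \<Rightarrow> 'b measure \<Rightarrow> bool" where
  "dense_in_L2 F Q \<longleftrightarrow> F \<subseteq> L2 Q \<and>
     (\<forall>h\<in>L2 Q. \<forall>\<epsilon>>0. \<exists>f\<in>F. sqrt (\<integral>x. (h x - f x)\<^sup>2 \<partial>Q) < \<epsilon>)"

text \<open>For probability measures \<open>F \<lless> G\<close> on the same space the integral below is at least 1,
  so the truncated subtraction of \<^typ>\<open>ennreal\<close> is never active.\<close>

definition chi2_divergence :: "'b measure \<Rightarrow> 'b measure \<Rightarrow> ennreal" where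
  "chi2_divergence F G =
     (if absolutely_continuous G F then (\<integral>\<^sup>+x. (RN_deriv G F x)\<^sup>2 \<partial>G) - 1 else \<infinity>)"

text \<open>The mixture distribution \<open>\<pi>P\<close> is \<^term>\<open>bind \<pi> P\<close>.  The supremum is taken in \<open>[0,\<infinity>]\<close>.
  The function \<^const>\<open>ennreal\<close> sends negative differences to 0; the pair \<open>\<pi> = \<pi>'\<close> always
  contributes the value 0, so for nonempty \<open>Priors\<close> this does not change the supremum.\<close>

definition chi2_modulus ::
  "('a \<Rightarrow> 'b measure) \<Rightarrow> 'a measure set \<Rightarrow> ('a measure \<Rightarrow> real) \<Rightarrow> real \<Rightarrow> ennreal" where
  "chi2_modulus P Priors T t =
     Sup {ennreal (T \<pi>' - T \<pi>) | \<pi> \<pi>'. \<pi> \<in> Priors \<and> \<pi>' \<in> Priors \<and>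
            chi2_divergence (bind \<pi>' P) (bind \<pi> P) \<le> ennreal (t\<^sup>2)}"

text \<open>The sample \<open>(X\<^sub>1, \<dots>, X\<^sub>n)\<close> is indexed by \<open>{..<n}\<close> and has the product law
  \<open>(\<pi>P)\<^sup>n\<close>.\<close>

definition worst_case_risk ::
  "('a \<Rightarrow> 'b measure) \<Rightarrow> 'a measure set \<Rightarrow> ('a measure \<Rightarrow> real) \<Rightarrow> nat \<Rightarrow> ((nat \<Rightarrow> 'b) \<Rightarrow> real) \<Rightarrow> ennreal"
  where
  "worst_case_risk P Priors T n That =
     (SUP \<pi>\<in>Priors. \<integral>\<^sup>+x. ennreal (\<bar>That x - T \<pi>\<bar>\<^sup>2) \<partial>(Pi\<^sub>M {..<n} (\<lambda>_. bind \<pi> P)))"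

definition minimax_risk ::
  "'b measure \<Rightarrow> ('a \<Rightarrow> 'b measure) \<Rightarrow> 'a measure set \<Rightarrow> ('a measure \<Rightarrow> real) \<Rightarrow> nat \<Rightarrow> ennreal" where
  "minimax_risk N P Priors T n =
     (INF That \<in> borel_measurable (Pi\<^sub>M {..<n} (\<lambda>_. N)). worst_case_risk P Priors T n That)"

end

theory Submission
  imports Defs
begin

text \<open>
  Lower bound: for \<open>\<chi>\<^sup>2(\<pi>'P \<parallel> \<pi>P) \<le> 1/n\<close> the \<open>n\<close>-fold likelihood ratio has second moment at most
  \<open>(1 + 1/n)\<^sup>n \<le> e\<close>, so by Cauchy-Schwarz an estimator of root mean squared error \<open>R\<close> under both laws
  has \<open>|T(\<pi>') - T(\<pi>)| \<le> (1 + \<surd>e) R\<close>.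

  Upper bound: the root mean squared error of an empirical mean of \<open>g\<close> is at most
  \<open>|\<pi>Pg - T(\<pi>)| + sd(g)/\<surd>n\<close>.  After optimising over an additive constant, the worst case of this over
  \<open>\<pi>\<close> is half the supremum over pairs \<open>(\<pi>, \<pi>')\<close> of a function that is concave in the pair and
  convex in \<open>g\<close>.  By Fan's minimax theorem it suffices to treat each pair separately.  Unless some
  multiple of some \<open>g\<close> makes the function arbitrarily small, \<open>|\<pi>Pg - \<pi>'Pg| \<le> (sd + sd')/\<surd>n\<close> for all
  \<open>g\<close>, which by density of \<open>F\<close> says that \<open>\<pi>P\<close> is within \<open>\<chi>\<^sup>2\<close>-distance \<open>1/n\<close> of a mixture of
  \<open>\<pi>P\<close> and \<open>\<pi>'P\<close>; affinity of \<open>T\<close> then bounds \<open>T(\<pi>) - T(\<pi>')\<close> by the modulus.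
\<close>

section \<open>Fan's minimax theorem\<close>

text \<open>Separation in the plane: the points lying below some \<open>(f x, h x)\<close> form a
  convex set that misses the open quadrant above \<open>(c, c)\<close>. The normal of a separating
  line has nonnegative coordinates, and normalising their sum to 1 gives \<open>l\<close>.\<close>

lemma concavelike_alternative_pair:
  fixes f h :: "'x \<Rightarrow> real"
  assumes concave: "\<And>x y l. \<lbrakk>x \<in> X; y \<in> X; 0 \<le> l; l \<le> 1\<rbrakk> \<Longrightarrow>
      \<exists>z\<in>X. (1 - l) * f x + l * f y \<le> f z \<and> (1 - l) * h x + l * h y \<le> h z"
    and alt: "\<And>x. x \<in> X \<Longrightarrow> f x \<le> c \<or> h x \<le> c"
  shows "\<exists>l. 0 \<le> l \<and> l \<le> 1 \<and> (\<forall>x\<in>X. (1 - l) * f x + l * h x \<le> c)"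
proof (cases "X = {}")
  case True
  then show ?thesis
    by (intro exI[of _ 0]) auto
next
  case False
  define A where "A = {p :: real \<times> real. \<exists>x\<in>X. fst p \<le> f x \<and> snd p \<le> h x}"
  define B where "B = {p :: real \<times> real. c < fst p \<and> c < snd p}"
  have "convex A"
    unfolding convex_alt
  proof safe
    fix u v u' v' l :: real
    assume "(u, v) \<in> A" "(u', v') \<in> A" and l: "0 \<le> l" "l \<le> 1"
    then obtain x y where x: "x \<in> X" "u \<le> f x" "v \<le> h x" and y: "y \<in> X" "u' \<le> f y" "v' \<le> h y"
      by (auto simp: A_def)
    from concave[OF x(1) y(1) l] obtain z where
      z: "z \<in> X" "(1 - l) * f x + l * f y \<le> f z" "(1 - l) * h x + l * h y \<le> h z"
      by auto
    have "(1 - l) * u + l * u' \<le> f z" "(1 - l) * v + l * v' \<le> h z"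
      by (rule order_trans[OF _ z(2)], intro add_mono mult_left_mono; use x y l in simp)
         (rule order_trans[OF _ z(3)], intro add_mono mult_left_mono; use x y l in simp)
    with z(1) show "(1 - l) *\<^sub>R (u, v) + l *\<^sub>R (u', v') \<in> A"
      by (auto simp: A_def)
  qed
  moreover have "convex B"
  proof -
    have "B = {c<..} \<times> {c<..}"
      by (auto simp: B_def)
    then show ?thesis
      by (simp add: convex_Times)
  qed
  moreover have "A \<noteq> {}"
    using False by (force simp: A_def)
  moreover have "B \<noteq> {}"
    by (auto simp: B_def intro!: exI[of _ "c + 1"])
  moreover have "A \<inter> B = {}"
    using alt by (force simp: A_def B_def)
  ultimately obtain a b where a: "a \<noteq> 0" and le: "\<And>p. p \<in> A \<Longrightarrow> a \<bullet> p \<le> b"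
    and ge: "\<And>p. p \<in> B \<Longrightarrow> b \<le> a \<bullet> p"
    using separating_hyperplane_sets[of A B] by blast
  obtain a1 a2 where a12: "a = (a1, a2)"
    by (cases a)
  have A: "a1 * f x + a2 * h x \<le> b" if "x \<in> X" for x
    using le[of "(f x, h x)"] that by (auto simp: A_def a12)
  have B: "b \<le> a1 * u + a2 * v" if "c < u" "c < v" for u v
    using ge[of "(u, v)"] that by (auto simp: B_def a12)
  have a1: "0 \<le> a1"
  proof (rule ccontr)
    assume neg: "\<not> 0 \<le> a1"
    \<comment> \<open>If \<open>a1\<close> were negative, this \<open>u\<close> would put
      \<open>(u, c + 1)\<close> into the quadrant with \<open>a1 * u + a2 * (c + 1)\<close> at most
      \<open>b - 1\<close>, on the wrong side of the line.\<close>
    define u where "u = max (c + 1) ((b - a2 * (c + 1) - 1) / a1)"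
    have "a1 * u \<le> a1 * ((b - a2 * (c + 1) - 1) / a1)"
      using neg by (intro mult_left_mono_neg) (auto simp: u_def)
    moreover have "c < u"
      by (auto simp: u_def less_max_iff_disj)
    ultimately show False
      using B[of u "c + 1"] neg by simp
  qed
  have a2: "0 \<le> a2"
  proof (rule ccontr)
    assume neg: "\<not> 0 \<le> a2"
    define u where "u = max (c + 1) ((b - a1 * (c + 1) - 1) / a2)"
    have "a2 * u \<le> a2 * ((b - a1 * (c + 1) - 1) / a2)"
      using neg by (intro mult_left_mono_neg) (auto simp: u_def)
    moreover have "c < u"
      by (auto simp: u_def less_max_iff_disj)
    ultimately show False
      using B[of "c + 1" u] neg by simp
  qed
  have pos: "0 < a1 + a2"
    using a a1 a2 by (auto simp: a12 zero_prod_def)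
  have b: "b \<le> (a1 + a2) * c"
  proof (rule field_le_epsilon)
    fix e :: real
    assume "0 < e"
    \<comment> \<open>The corner \<open>(c, c)\<close> is not in the open quadrant, so it is
      approached along the diagonal; the offset is scaled to contribute exactly
      \<open>e\<close>.\<close>
    then have "b \<le> a1 * (c + e / (a1 + a2)) + a2 * (c + e / (a1 + a2))"
      using pos by (intro B) auto
    also have "\<dots> = (a1 + a2) * c + (a1 + a2) * (e / (a1 + a2))"
      by (simp add: algebra_simps add_divide_distrib)
    finally show "b \<le> (a1 + a2) * c + e"
      using pos by simp
  qed
  show ?thesis
  proof (intro exI conjI ballI)
    show "0 \<le> a2 / (a1 + a2)" "a2 / (a1 + a2) \<le> 1"
      using a1 a2 pos by auto
    fix x
    assume "x \<in> X"
    have "1 - a2 / (a1 + a2) = a1 / (a1 + a2)"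
      using pos by (simp add: field_simps)
    then have "(1 - a2 / (a1 + a2)) * f x + a2 / (a1 + a2) * h x = (a1 * f x + a2 * h x) / (a1 + a2)"
      by (simp add: add_divide_distrib)
    also have "\<dots> \<le> c"
      using A[OF \<open>x \<in> X\<close>] b pos by (simp add: pos_divide_le_eq mult.commute)
    finally show "(1 - a2 / (a1 + a2)) * f x + a2 / (a1 + a2) * h x \<le> c" .
  qed
qed

text \<open>Induction on \<open>S\<close>. Only the points where \<open>g\<close> exceeds
  \<open>c\<close> need the remaining functions, and they again form a concavelike set, so one
  \<open>h\<close> serves all of them. The two-function case merges \<open>g\<close> and
  \<open>h\<close>, and convexity in \<open>G\<close> realises the merged bound. Convexity refers to
  the fixed set \<open>Y\<close> because \<open>X\<close> shrinks during the induction.\<close>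

lemma concavelike_alternative_finite:
  fixes L :: "'x \<Rightarrow> 'g \<Rightarrow> real"
  assumes convex: "\<And>g h l. \<lbrakk>g \<in> G; h \<in> G; 0 \<le> l; l \<le> 1\<rbrakk> \<Longrightarrow>
      \<exists>k\<in>G. \<forall>x. x \<in> Y \<longrightarrow> L x k \<le> (1 - l) * L x g + l * L x h"
    and S: "finite S" "S \<noteq> {}" "S \<subseteq> G"
    and X: "X \<subseteq> Y"
    and concave: "\<And>x y l. \<lbrakk>x \<in> X; y \<in> X; 0 \<le> l; l \<le> 1\<rbrakk> \<Longrightarrow>
      \<exists>z\<in>X. \<forall>g\<in>G. (1 - l) * L x g + l * L y g \<le> L z g"
    and alt: "\<And>x. x \<in> X \<Longrightarrow> \<exists>g\<in>S. L x g \<le> c"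
  shows "\<exists>g\<in>G. \<forall>x\<in>X. L x g \<le> c"
  using S X concave alt
proof (induction S arbitrary: X rule: finite_ne_induct)
  case (singleton g)
  then show ?case
    by blast
next
  case (insert g S)
  define X' where "X' = {x \<in> X. c < L x g}"
  have "\<exists>h\<in>G. \<forall>x\<in>X'. L x h \<le> c"
  proof (rule insert.IH)
    show "S \<subseteq> G" "X' \<subseteq> Y"
      using insert.prems by (auto simp: X'_def)
    show "\<exists>h\<in>S. L x h \<le> c" if "x \<in> X'" for x
      using insert.prems(4)[of x] that by (auto simp: X'_def)
    fix x y and l :: real
    assume xy: "x \<in> X'" "y \<in> X'" and l: "0 \<le> l" "l \<le> 1"
    then obtain z where z: "z \<in> X" "\<forall>g\<in>G. (1 - l) * L x g + l * L y g \<le> L z g"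
      using insert.prems(3)[of x y l] by (auto simp: X'_def)
    have "c < (1 - l) * L x g + l * L y g"
      \<comment> \<open>The library bound is for strict upper bounds, hence the negated
        values.\<close>
      using convex_bound_lt[of "- L x g" "- c" "- L y g" "1 - l" l] xy l by (auto simp: X'_def)
    also have "\<dots> \<le> L z g"
      using z insert.prems by auto
    finally show "\<exists>z\<in>X'. \<forall>g\<in>G. (1 - l) * L x g + l * L y g \<le> L z g"
      using z by (auto simp: X'_def)
  qed
  then obtain h where h: "h \<in> G" "\<And>x. x \<in> X' \<Longrightarrow> L x h \<le> c"
    by auto
  have g: "g \<in> G"
    using insert.prems by auto
  have "\<exists>l. 0 \<le> l \<and> l \<le> 1 \<and> (\<forall>x\<in>X. (1 - l) * L x g + l * L x h \<le> c)"
  proof (rule concavelike_alternative_pair)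
    show "\<exists>z\<in>X. (1 - l) * L x g + l * L y g \<le> L z g \<and> (1 - l) * L x h + l * L y h \<le> L z h"
      if "x \<in> X" "y \<in> X" "0 \<le> l" "l \<le> 1" for x y l
      using insert.prems(3)[OF that] g h(1) by blast
    show "L x g \<le> c \<or> L x h \<le> c" if "x \<in> X" for x
      using h(2)[of x] that by (force simp: X'_def)
  qed
  then obtain l where l: "0 \<le> l" "l \<le> 1" "\<And>x. x \<in> X \<Longrightarrow> (1 - l) * L x g + l * L x h \<le> c"
    by auto
  with convex[OF g h(1) l(1,2)] insert.prems(2) show ?case
    by (meson order_trans subsetD)
qed

text \<open>The strict sublevel sets of the functions \<open>L x g\<close> form an open cover, so by
  compactness finitely many \<open>g\<close> suffice. Strictness in the hypothesis makes these sets
  open and lets the conclusion hold at the level \<open>c\<close> itself, without an additional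
  epsilon.\<close>

theorem fan_minimax:
  fixes L :: "'x \<Rightarrow> 'g \<Rightarrow> real"
  assumes compact: "compact_space \<tau>"
    and closed: "\<And>g. g \<in> G \<Longrightarrow> closedin \<tau> {x \<in> topspace \<tau>. c \<le> L x g}"
    and concave: "\<And>x y l. \<lbrakk>x \<in> topspace \<tau>; y \<in> topspace \<tau>; 0 \<le> l; l \<le> 1\<rbrakk> \<Longrightarrow>
      \<exists>z\<in>topspace \<tau>. \<forall>g\<in>G. (1 - l) * L x g + l * L y g \<le> L z g"
    and convex: "\<And>g h l. \<lbrakk>g \<in> G; h \<in> G; 0 \<le> l; l \<le> 1\<rbrakk> \<Longrightarrow>
      \<exists>k\<in>G. \<forall>x. x \<in> topspace \<tau> \<longrightarrow> L x k \<le> (1 - l) * L x g + l * L x h"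
    and less: "\<And>x. x \<in> topspace \<tau> \<Longrightarrow> \<exists>g\<in>G. L x g < c"
    and G: "G \<noteq> {}"
  shows "\<exists>g\<in>G. \<forall>x\<in>topspace \<tau>. L x g \<le> c"
proof -
  define U where "U g = {x \<in> topspace \<tau>. L x g < c}" for g
  have "U g = topspace \<tau> - {x \<in> topspace \<tau>. c \<le> L x g}" for g
    by (auto simp: U_def)
  with closed have "\<forall>V\<in>U ` G. openin \<tau> V"
    by auto
  moreover have "\<Union> (U ` G) = topspace \<tau>"
    using less by (auto simp: U_def)
  ultimately obtain V where "finite V" "V \<subseteq> U ` G" "\<Union> V = topspace \<tau>"
    using compact unfolding compact_space by meson
  then obtain S where S: "finite S" "S \<subseteq> G" "\<Union> (U ` S) = topspace \<tau>"
    by (metis finite_subset_image)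
  obtain g where "g \<in> G"
    using G by auto
  show ?thesis
  \<comment> \<open>Inserting \<open>g\<close> keeps the finite family nonempty even if the space,
    and with it the subcover, is empty.\<close>
  proof (rule concavelike_alternative_finite[OF convex, where S = "insert g S"])
    show "\<exists>h\<in>insert g S. L x h \<le> c" if "x \<in> topspace \<tau>" for x
      using that S(3) by (force simp: U_def)
  qed (use S \<open>g \<in> G\<close> concave in auto)
qed

section \<open>Integration against convex combinations of measures\<close>

lemma nn_integral_mixture:
  assumes sets: "sets B = sets A" and f: "f \<in> borel_measurable A"
  shows "(\<integral>\<^sup>+x. f x \<partial>mixture l A B) =
    ennreal (1 - l) * (\<integral>\<^sup>+x. f x \<partial>A) + ennreal l * (\<integral>\<^sup>+x. f x \<partial>B)"
  using f
proof induction
  case (cong f g)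
  have "space B = space A"
    using sets by (rule sets_eq_imp_space_eq)
  with cong(3) have "(\<integral>\<^sup>+x. f x \<partial>mixture l A B) = (\<integral>\<^sup>+x. g x \<partial>mixture l A B)"
    "(\<integral>\<^sup>+x. f x \<partial>A) = (\<integral>\<^sup>+x. g x \<partial>A)" "(\<integral>\<^sup>+x. f x \<partial>B) = (\<integral>\<^sup>+x. g x \<partial>B)"
    by (auto intro!: nn_integral_cong)
  with cong show ?case
    by simp
next
  case (set S)
  then show ?case
    using sets by (simp add: emeasure_mixture)
next
  case (mult u c)
  then have "u \<in> borel_measurable B" "u \<in> borel_measurable (mixture l A B)"
    using sets by (simp_all cong: measurable_cong_sets)
  with mult show ?case
    by (simp add: nn_integral_cmult distrib_left mult.left_commute)
next
  case (add u v)
  then have "u \<in> borel_measurable B" "u \<in> borel_measurable (mixture l A B)"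
    "v \<in> borel_measurable B" "v \<in> borel_measurable (mixture l A B)"
    using sets by (simp_all cong: measurable_cong_sets)
  with add show ?case
    by (simp add: nn_integral_add distrib_left ac_simps)
next
  case (seq U)
  then have m: "U i \<in> borel_measurable B" "U i \<in> borel_measurable (mixture l A B)" for i
    using sets by (simp_all cong: measurable_cong_sets)
  \<comment> \<open>Monotonicity of both sequences of integrals lets the supremum of their sum split
    into the sum of the suprema.\<close>
  have inc: "incseq (\<lambda>i. ennreal c * integral\<^sup>N D (U i))" for c D
    using \<open>incseq U\<close>
    by (auto simp: incseq_def le_fun_def intro!: mult_left_mono nn_integral_mono)
  show ?case
    using seq m inc
    by (simp add: nn_integral_monotone_convergence_SUP image_comp SUP_mult_left_ennreal
        ennreal_SUP_add)
qed

lemma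
  fixes f :: "'a \<Rightarrow> real"
  assumes sets: "sets B = sets A" and l: "0 \<le> l" "l \<le> 1"
    and f: "integrable A f" "integrable B f"
  shows integrable_mixture: "integrable (mixture l A B) f"
    and integral_mixture: "(\<integral>x. f x \<partial>mixture l A B) = (1 - l) * (\<integral>x. f x \<partial>A) + l * (\<integral>x. f x \<partial>B)"
proof -
  have fm: "f \<in> borel_measurable A"
    using f by auto
  then have m: "f \<in> borel_measurable (mixture l A B)"
    by (simp cong: measurable_cong_sets)
  have fin: "(\<integral>\<^sup>+x. ennreal (f x) \<partial>D) < \<infinity>" "(\<integral>\<^sup>+x. ennreal (- f x) \<partial>D) < \<infinity>"
    if "integrable D f" for D
    using that by (auto simp: real_integrable_def less_top)
  show I: "integrable (mixture l A B) f"
    using fin[OF f(1)] fin[OF f(2)] m fm sets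
    by (auto simp: real_integrable_def nn_integral_mixture ennreal_mult_eq_top_iff)
  \<comment> \<open>\<open>enn2real\<close> respects sums only for finite values; \<open>fin\<close>
    supplies this for the positive and negative parts.\<close>
  have e: "enn2real (ennreal (1 - l) * x + ennreal l * y) = (1 - l) * enn2real x + l * enn2real y"
    if "x < \<infinity>" "y < \<infinity>" for x y
    using that l by (simp add: enn2real_plus enn2real_mult ennreal_mult_less_top)
  show "(\<integral>x. f x \<partial>mixture l A B) = (1 - l) * (\<integral>x. f x \<partial>A) + l * (\<integral>x. f x \<partial>B)"
    using fm sets f fin[OF f(1)] fin[OF f(2)] I
    by (simp add: real_lebesgue_integral_def nn_integral_mixture e) (simp add: algebra_simps)
qed

text \<open>The measure of a set under \<open>bind\<close> is an integral of the kernel against the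
  prior, hence linear in the prior. This transfers convex combinations of priors to the laws of an
  observation.\<close>

lemma bind_mixture:
  assumes A: "A \<in> space (prob_algebra M)" and B: "B \<in> space (prob_algebra M)"
    and P: "P \<in> M \<rightarrow>\<^sub>M prob_algebra N"
  shows "bind (mixture l A B) P = mixture l (bind A P) (bind B P)"
proof -
  have s: "sets A = sets M" "sets B = sets M" and "prob_space A" "prob_space B"
    using A B by (auto simp: space_prob_algebra)
  then have ne: "space A \<noteq> {}" "space B \<noteq> {}"
    by (simp_all add: prob_space.not_empty)
  have P': "P \<in> A \<rightarrow>\<^sub>M subprob_algebra N" "P \<in> B \<rightarrow>\<^sub>M subprob_algebra N"
    "P \<in> mixture l A B \<rightarrow>\<^sub>M subprob_algebra N"
    using measurable_prob_algebraD[OF P] s by (simp_all cong: measurable_cong_sets)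
  have sb: "sets (bind A P) = sets N" "sets (bind B P) = sets N"
    "sets (bind (mixture l A B) P) = sets N"
    using sets_bind P' ne sets_kernel by (metis space_mixture)+
  show ?thesis
  proof (rule measure_eqI)
    show "sets (bind (mixture l A B) P) = sets (mixture l (bind A P) (bind B P))"
      by (simp add: sb)
    fix X
    assume "X \<in> sets (bind (mixture l A B) P)"
    then have X: "X \<in> sets N"
      by (simp add: sb)
    then have "(\<lambda>x. emeasure (P x) X) \<in> borel_measurable A"
      using P' by (auto intro: measurable_emeasure_kernel)
    then show "emeasure (bind (mixture l A B) P) X = emeasure (mixture l (bind A P) (bind B P)) X"
      using emeasure_bind[OF ne(1) P'(1) X] emeasure_bind[OF ne(2) P'(2) X]
        emeasure_bind[OF _ P'(3) X] ne X s sb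
      by (simp add: emeasure_mixture nn_integral_mixture)
  qed
qed

section \<open>The chi-squared divergence\<close>

lemma integrable_mult_of_square_integrable:
  fixes f g :: "'a \<Rightarrow> real"
  assumes [measurable]: "f \<in> borel_measurable M" "g \<in> borel_measurable M"
    and f2: "integrable M (\<lambda>x. (f x)\<^sup>2)" and g2: "integrable M (\<lambda>x. (g x)\<^sup>2)"
  shows "integrable M (\<lambda>x. f x * g x)"
proof (rule Bochner_Integration.integrable_bound)
  show "integrable M (\<lambda>x. (f x)\<^sup>2 + (g x)\<^sup>2)"
    using f2 g2 by simp
  have "\<bar>f x * g x\<bar> \<le> (f x)\<^sup>2 + (g x)\<^sup>2" for x
  proof -
    have "0 \<le> \<bar>f x\<bar> * \<bar>g x\<bar>"
      by simp
    with sum_squares_bound[of "\<bar>f x\<bar>" "\<bar>g x\<bar>"] show ?thesis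
      unfolding abs_mult power2_abs by linarith
  qed
  then show "AE x in M. norm (f x * g x) \<le> norm ((f x)\<^sup>2 + (g x)\<^sup>2)"
    by simp
qed simp

text \<open>The representer \<open>p = dH/dG - 1\<close> satisfies \<open>H f - G f = \<integral> p f dG\<close>; expanding
  \<open>\<integral> (p - f)\<^sup>2 dG\<close> for an approximation \<open>f\<close> of \<open>p\<close> gives \<open>\<integral> p\<^sup>2 dG \<le> t\<close> up to the approximation error.\<close>

lemma chi2_divergence_le:
  assumes G: "prob_space G" and H: "prob_space H" and sets: "sets H = sets G"
    and dom: "\<And>f. f \<in> borel_measurable G \<Longrightarrow> (\<integral>\<^sup>+x. f x \<partial>H) \<le> ennreal C * (\<integral>\<^sup>+x. f x \<partial>G)"
    and dense: "dense_in_L2 F G"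
    and t: "0 \<le> t"
    and var: "\<And>f. f \<in> F \<Longrightarrow> ((\<integral>x. f x \<partial>H) - (\<integral>x. f x \<partial>G))\<^sup>2 \<le> t * (\<integral>x. (f x)\<^sup>2 \<partial>G)"
  shows "chi2_divergence H G \<le> ennreal t"
proof -
  interpret G: prob_space G by fact
  interpret H: prob_space H by fact
  have ac: "absolutely_continuous G H"
    unfolding absolutely_continuous_def
  proof (safe intro!: null_setsI)
    fix A
    assume A: "A \<in> null_sets G"
    then have "emeasure H A = (\<integral>\<^sup>+x. indicator A x \<partial>H)"
      using sets by auto
    also have "\<dots> \<le> ennreal C * (\<integral>\<^sup>+x. indicator A x \<partial>G)"
      using A by (intro dom) auto
    also have "\<dots> = 0"
      using A by (simp add: null_sets_def)
    finally show "emeasure H A = 0"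
      by simp
    show "A \<in> sets H"
      using A sets by auto
  qed
  define r where "r = RN_deriv G H"
  have [measurable]: "r \<in> borel_measurable G"
    by (simp add: r_def)
  have Hd: "H = density G r"
    using G.density_RN_deriv[OF ac sets] by (simp add: r_def)
  have nn: "(\<integral>\<^sup>+x. f x \<partial>H) = (\<integral>\<^sup>+x. r x * f x \<partial>G)" if [measurable]: "f \<in> borel_measurable G" for f
    by (subst Hd) (simp add: nn_integral_density)
  have r1: "(\<integral>\<^sup>+x. r x \<partial>G) = 1"
    using nn[of "\<lambda>_. 1"] H.emeasure_space_1 by simp
  have r2: "(\<integral>\<^sup>+x. (r x)\<^sup>2 \<partial>G) \<le> ennreal C"
    \<comment> \<open>Domination applied to the density itself: the integral of \<open>r\<close>
      squared under \<open>G\<close> is that of \<open>r\<close> under \<open>H\<close>, hence at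
      most \<open>C\<close>. This a priori square integrability is what allows approximation from
      \<open>F\<close>.\<close>
    using dom[of r] nn[of r] r1 by (simp add: power2_eq_square)
  have "AE x in G. r x \<noteq> \<infinity>"
    using r1 by (intro nn_integral_PInf_AE) auto
  define q where "q x = enn2real (r x)" for x
  have q0: "0 \<le> q x" for x
    by (simp add: q_def)
  have [measurable]: "q \<in> borel_measurable G"
    unfolding q_def[abs_def] by measurable
  have rq: "AE x in G. r x = ennreal (q x)"
    using \<open>AE x in G. r x \<noteq> \<infinity>\<close> by eventually_elim (auto simp: q_def less_top)
  have qq: "(\<integral>\<^sup>+x. ennreal ((q x)\<^sup>2) \<partial>G) = (\<integral>\<^sup>+x. (r x)\<^sup>2 \<partial>G)"
    using rq by (intro nn_integral_cong_AE) (auto simp: ennreal_power q0)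
  have q2: "integrable G (\<lambda>x. (q x)\<^sup>2)"
    using r2 qq by (intro integrableI_bounded) (auto intro: le_less_trans)
  have q1: "integrable G q"
    using G.square_integrable_imp_integrable[OF _ q2] by simp
  have Hq: "H = density G (\<lambda>x. ennreal (q x))"
    by (subst Hd) (rule density_cong, use rq in auto)
  have Eq: "(\<integral>x. q x \<partial>G) = 1"
    using H.prob_space integral_density[of "\<lambda>_. 1::real" G q] by (simp add: q0 Hq)
  define p where "p x = q x - 1" for x
  have p2: "integrable G (\<lambda>x. (p x)\<^sup>2)"
    using q1 q2 by (simp add: p_def power2_diff)
  have Np: "(\<integral>x. (p x)\<^sup>2 \<partial>G) = (\<integral>x. (q x)\<^sup>2 \<partial>G) - 1"
    using q1 q2 Eq by (simp add: p_def power2_diff G.prob_space)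
  have "(\<integral>x. (p x)\<^sup>2 \<partial>G) \<le> t"
  proof (rule field_le_epsilon)
    fix e :: real
    assume "0 < e"
    have "p \<in> borel_measurable G"
      unfolding p_def[abs_def] by measurable
    with p2 have "p \<in> L2 G"
      by (simp add: L2_def)
    moreover have "0 < sqrt e"
      using \<open>0 < e\<close> by simp
    ultimately obtain f where f: "f \<in> F" and d: "sqrt (\<integral>x. (p x - f x)\<^sup>2 \<partial>G) < sqrt e"
      using dense unfolding dense_in_L2_def by blast
    have fm[measurable]: "f \<in> borel_measurable G" and f2: "integrable G (\<lambda>x. (f x)\<^sup>2)"
      using f dense by (auto simp: dense_in_L2_def L2_def)
    have f1: "integrable G f"
      using G.square_integrable_imp_integrable[OF _ f2] by simp
    have qf: "integrable G (\<lambda>x. q x * f x)"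
      by (rule integrable_mult_of_square_integrable) (use q2 f2 in auto)
    have "(\<integral>x. f x \<partial>H) = (\<integral>x. q x * f x \<partial>G)"
      unfolding Hq by (subst integral_density) (auto simp: q0)
    then have Hf: "(\<integral>x. f x \<partial>H) - (\<integral>x. f x \<partial>G) = (\<integral>x. p x * f x \<partial>G)"
      using qf f1 by (simp add: p_def left_diff_distrib)
    have pf: "integrable G (\<lambda>x. p x * f x)"
      using qf f1 by (simp add: p_def left_diff_distrib)
    let ?S = "\<integral>x. (f x)\<^sup>2 \<partial>G" and ?I = "\<integral>x. p x * f x \<partial>G"
    have "0 \<le> ?S"
      by simp
    \<comment> \<open>By the arithmetic-geometric mean inequality, twice \<open>?I\<close> is at
      most \<open>t + ?S\<close>. In the expansion of the squared distance of \<open>p\<close> and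
      \<open>f\<close> the unknown norm \<open>?S\<close> then cancels.\<close>
    have "?I\<^sup>2 \<le> t * ?S"
      using var[OF f] Hf by simp
    also have "\<dots> \<le> ((t + ?S) / 2)\<^sup>2"
      using sum_squares_bound[of t ?S] by (simp add: power2_eq_square field_simps)
    finally have "?I \<le> (t + ?S) / 2"
      by (rule power2_le_imp_le) (use t \<open>0 \<le> ?S\<close> in auto)
    then have "2 * ?I \<le> t + ?S"
      by simp
    moreover have "(\<integral>x. (p x - f x)\<^sup>2 \<partial>G) = (\<integral>x. (p x)\<^sup>2 + (f x)\<^sup>2 - 2 * (p x * f x) \<partial>G)"
      by (simp add: power2_diff mult.assoc)
    moreover have "\<dots> = (\<integral>x. (p x)\<^sup>2 \<partial>G) + ?S - 2 * ?I"
      using p2 f2 pf by simp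
    moreover have "(\<integral>x. (p x - f x)\<^sup>2 \<partial>G) < e"
      using d by simp
    ultimately show "(\<integral>x. (p x)\<^sup>2 \<partial>G) \<le> t + e"
      by linarith
  qed
  then have "(\<integral>x. (q x)\<^sup>2 \<partial>G) \<le> t + 1"
    using Np by simp
  then have "(\<integral>\<^sup>+x. (r x)\<^sup>2 \<partial>G) \<le> ennreal (t + 1)"
    using qq q2 by (simp add: nn_integral_eq_integral ennreal_leI flip: qq)
  also have "\<dots> = ennreal t + 1"
    using t by simp
  finally show ?thesis
    using ac by (simp add: chi2_divergence_def ennreal_minus_le_iff add.commute r_def)
qed

lemma nn_integral_RN_deriv_power2_le:
  assumes "chi2_divergence H G \<le> ennreal t" "0 \<le> t"
  shows "absolutely_continuous G H" "(\<integral>\<^sup>+x. (RN_deriv G H x)\<^sup>2 \<partial>G) \<le> ennreal (1 + t)"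
proof -
  show "absolutely_continuous G H"
    using assms(1) by (auto simp: chi2_divergence_def top_unique split: if_splits)
  with assms show "(\<integral>\<^sup>+x. (RN_deriv G H x)\<^sup>2 \<partial>G) \<le> ennreal (1 + t)"
    by (simp add: chi2_divergence_def ennreal_minus_le_iff add.commute)
qed

section \<open>Products of densities and Le Cam's two-point bound\<close>

text \<open>A product measure is determined by its values on boxes. There the indicator factorises
  over the coordinates, so the integral of the product density becomes a product of one-dimensional
  integrals.\<close>

lemma PiM_density:
  assumes I: "finite I" and G: "prob_space G" and H: "prob_space (density G r)"
    and r[measurable]: "r \<in> borel_measurable G"
  shows "Pi\<^sub>M I (\<lambda>_. density G r) = density (Pi\<^sub>M I (\<lambda>_. G)) (\<lambda>x. \<Prod>i\<in>I. r (x i))"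
proof -
  interpret G: prob_space G by fact
  interpret GI: product_sigma_finite "\<lambda>_. G" by standard
  interpret H: prob_space "density G r" by fact
  interpret HI: product_sigma_finite "\<lambda>_. density G r" by standard
  have [measurable]: "(\<lambda>x. \<Prod>i\<in>I. r (x i)) \<in> borel_measurable (Pi\<^sub>M I (\<lambda>_. G))"
    by measurable
  show ?thesis
  proof (rule HI.PiM_eqI[symmetric])
    show "sets (density (Pi\<^sub>M I (\<lambda>_. G)) (\<lambda>x. \<Prod>i\<in>I. r (x i))) = sets (Pi\<^sub>M I (\<lambda>_. density G r))"
      by (simp cong: sets_PiM_cong)
    fix A
    assume "\<And>i. i \<in> I \<Longrightarrow> A i \<in> sets (density G r)"
    then have A[measurable]: "\<And>i. i \<in> I \<Longrightarrow> A i \<in> sets G"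
      by simp
    then have AI: "Pi\<^sub>E I A \<in> sets (Pi\<^sub>M I (\<lambda>_. G))"
      using I by (intro sets_PiM_I_finite) auto
    have "emeasure (density (Pi\<^sub>M I (\<lambda>_. G)) (\<lambda>x. \<Prod>i\<in>I. r (x i))) (Pi\<^sub>E I A) =
        (\<integral>\<^sup>+x. (\<Prod>i\<in>I. r (x i)) * indicator (Pi\<^sub>E I A) x \<partial>Pi\<^sub>M I (\<lambda>_. G))"
      using AI by (simp add: emeasure_density)
    also have "\<dots> = (\<integral>\<^sup>+x. (\<Prod>i\<in>I. r (x i) * indicator (A i) (x i)) \<partial>Pi\<^sub>M I (\<lambda>_. G))"
    proof (rule nn_integral_cong)
      fix x
      assume "x \<in> space (Pi\<^sub>M I (\<lambda>_. G))"
      then have "indicator (Pi\<^sub>E I A) x = (\<Prod>i\<in>I. indicator (A i) (x i) :: ennreal)"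
        using I by (auto simp: indicator_def space_PiM PiE_iff prod_zero_iff)
      then show "(\<Prod>i\<in>I. r (x i)) * indicator (Pi\<^sub>E I A) x = (\<Prod>i\<in>I. r (x i) * indicator (A i) (x i))"
        by (simp add: prod.distrib)
    qed
    also have "\<dots> = (\<Prod>i\<in>I. \<integral>\<^sup>+x. r x * indicator (A i) x \<partial>G)"
      using I by (intro GI.product_nn_integral_prod) auto
    also have "\<dots> = (\<Prod>i\<in>I. emeasure (density G r) (A i))"
      by (intro prod.cong) (auto simp: emeasure_density)
    finally show "emeasure (density (Pi\<^sub>M I (\<lambda>_. G)) (\<lambda>x. \<Prod>i\<in>I. r (x i))) (Pi\<^sub>E I A) =
      (\<Prod>i\<in>I. emeasure (density G r) (A i))" .
  qed fact
qed

lemma ennreal_power2_le_imp_le: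
  assumes "x\<^sup>2 \<le> (ennreal y)\<^sup>2" "0 \<le> y"
  shows "x \<le> ennreal y"
proof (cases x)
  case (real u)
  with assms show ?thesis
    by (auto simp: ennreal_power intro: power2_le_imp_le)
next
  case top
  with assms show ?thesis
    by (auto simp: ennreal_power top_unique)
qed

text \<open>The triangle inequality is integrated under the law \<open>H\<close> of the sample only.
  The error around \<open>b\<close> costs \<open>R\<close> directly; the error around
  \<open>a\<close> is moved to \<open>G\<close> with the likelihood ratio and costs
  \<open>sqrt (exp 1) * R\<close>.\<close>

lemma two_point_lower_bound:
  fixes a b R :: real
  assumes G: "prob_space G" and H: "prob_space H" and sets: "sets H = sets G"
    and ac: "absolutely_continuous G H"
    and chi2: "(\<integral>\<^sup>+x. (RN_deriv G H x)\<^sup>2 \<partial>G) \<le> ennreal (1 + 1 / real n)"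
    and n: "n \<ge> 1" and R: "0 \<le> R"
    and f[measurable]: "f \<in> borel_measurable (Pi\<^sub>M {..<n} (\<lambda>_. G))"
    and riskG: "(\<integral>\<^sup>+x. ennreal (\<bar>f x - a\<bar>\<^sup>2) \<partial>Pi\<^sub>M {..<n} (\<lambda>_. G)) \<le> ennreal (R\<^sup>2)"
    and riskH: "(\<integral>\<^sup>+x. ennreal (\<bar>f x - b\<bar>\<^sup>2) \<partial>Pi\<^sub>M {..<n} (\<lambda>_. H)) \<le> ennreal (R\<^sup>2)"
  shows "\<bar>b - a\<bar> \<le> (1 + sqrt (exp 1)) * R"
proof -
  interpret G: prob_space G by fact
  interpret GI: product_sigma_finite "\<lambda>_. G" by standard
  interpret H: prob_space H by fact
  let ?G = "Pi\<^sub>M {..<n} (\<lambda>_. G)" and ?H = "Pi\<^sub>M {..<n} (\<lambda>_. H)"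
  interpret GG: prob_space ?G
    by (intro prob_space_PiM G)
  interpret HH: prob_space ?H
    by (intro prob_space_PiM H)
  define r where "r = RN_deriv G H"
  define \<rho> where "\<rho> x = (\<Prod>i<n. r (x i))" for x
  have [measurable]: "r \<in> borel_measurable G"
    by (simp add: r_def)
  have \<rho>[measurable]: "\<rho> \<in> borel_measurable ?G"
    unfolding \<rho>_def by measurable
  have Hr: "H = density G r"
    using G.density_RN_deriv[OF ac sets] by (simp add: r_def)
  then have HI: "?H = density ?G \<rho>"
    using PiM_density[of "{..<n}" G r] G H unfolding \<rho>_def by simp
  have "sets ?H = sets ?G"
    unfolding HI by simp
  then have fH[measurable]: "f \<in> borel_measurable ?H"
    using f by (simp cong: measurable_cong_sets)
  have "(\<integral>\<^sup>+x. (\<rho> x)\<^sup>2 \<partial>?G) = (\<integral>\<^sup>+x. (\<Prod>i<n. (r (x i))\<^sup>2) \<partial>?G)"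
    by (simp add: \<rho>_def prod_power_distrib)
  \<comment> \<open>Independence of the coordinates turns the second moment of the likelihood ratio
    into an \<open>n\<close>-th power.\<close>
  also have "\<dots> = (\<Prod>i<n. \<integral>\<^sup>+x. (r x)\<^sup>2 \<partial>G)"
    by (intro GI.product_nn_integral_prod) auto
  also have "\<dots> \<le> ennreal (1 + 1 / real n) ^ n"
    using chi2 by (simp add: r_def power_mono_ennreal)
  also have "\<dots> = ennreal ((1 + 1 / real n) ^ n)"
    by (rule ennreal_power) simp
  also have "\<dots> \<le> ennreal (exp 1)"
    using n exp_ge_one_plus_x_over_n_power_n[of n 1] by (intro ennreal_leI) auto
  finally have \<rho>2: "(\<integral>\<^sup>+x. (\<rho> x)\<^sup>2 \<partial>?G) \<le> ennreal (exp 1)" .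
  let ?A = "\<integral>\<^sup>+x. ennreal \<bar>f x - a\<bar> \<partial>?H" and ?B = "\<integral>\<^sup>+x. ennreal \<bar>f x - b\<bar> \<partial>?H"
  have "?A = (\<integral>\<^sup>+x. \<rho> x * ennreal \<bar>f x - a\<bar> \<partial>?G)"
    unfolding HI by (simp add: nn_integral_density)
  then have "?A\<^sup>2 \<le> (\<integral>\<^sup>+x. (\<rho> x)\<^sup>2 \<partial>?G) * (\<integral>\<^sup>+x. (ennreal \<bar>f x - a\<bar>)\<^sup>2 \<partial>?G)"
    by (simp add: Cauchy_Schwarz_nn_integral)
  also have "\<dots> \<le> ennreal (exp 1) * ennreal (R\<^sup>2)"
    using riskG \<rho>2 by (intro mult_mono) (auto simp: ennreal_power)
  also have "\<dots> = (ennreal (sqrt (exp 1) * R))\<^sup>2"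
    using R by (simp add: ennreal_power power_mult_distrib flip: ennreal_mult)
  finally have A: "?A \<le> ennreal (sqrt (exp 1) * R)"
    by (rule ennreal_power2_le_imp_le) (use R in simp)
  \<comment> \<open>Cauchy-Schwarz against the constant 1, whose integral is 1 under a probability
    measure.\<close>
  have "?B\<^sup>2 \<le> (\<integral>\<^sup>+x. (ennreal \<bar>f x - b\<bar>)\<^sup>2 \<partial>?H) * (\<integral>\<^sup>+x. 1\<^sup>2 \<partial>?H)"
    using Cauchy_Schwarz_nn_integral[of "\<lambda>x. ennreal \<bar>f x - b\<bar>" ?H "\<lambda>_. 1"] by simp
  also have "\<dots> \<le> (ennreal R)\<^sup>2"
    using riskH R by (simp add: ennreal_power HH.emeasure_space_1)
  finally have B: "?B \<le> ennreal R"
    by (rule ennreal_power2_le_imp_le) (use R in simp)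
  have "ennreal \<bar>b - a\<bar> = (\<integral>\<^sup>+x. ennreal \<bar>b - a\<bar> \<partial>?H)"
    by (simp add: HH.emeasure_space_1)
  also have "\<dots> \<le> (\<integral>\<^sup>+x. ennreal \<bar>f x - a\<bar> + ennreal \<bar>f x - b\<bar> \<partial>?H)"
    by (intro nn_integral_mono) (auto simp flip: ennreal_plus)
  also have "\<dots> = ?A + ?B"
    by (intro nn_integral_add) auto
  also have "\<dots> \<le> ennreal (sqrt (exp 1) * R) + ennreal R"
    using A B by (rule add_mono)
  also have "\<dots> = ennreal ((1 + sqrt (exp 1)) * R)"
    using R by (simp add: algebra_simps flip: ennreal_plus)
  finally show ?thesis
    using R by (simp add: ennreal_le_iff)
qed

section \<open>The risk of an empirical mean\<close>

text \<open>Bias-variance decomposition. With \<open>h\<close> the centred version of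
  \<open>g\<close>, the squared error expands into a double sum over pairs of coordinates, a linear
  term of mean 0 and the squared bias; independence leaves only the diagonal of the double
  sum.\<close>

lemma nn_integral_empirical_mean_power2:
  fixes g :: "'b \<Rightarrow> real" and a :: real
  assumes Q: "prob_space Q" and g[measurable]: "g \<in> borel_measurable Q"
    and g2: "integrable Q (\<lambda>x. (g x)\<^sup>2)" and n: "n \<ge> 1"
  shows "(\<integral>\<^sup>+x. ennreal (\<bar>1 / real n * (\<Sum>i<n. g (x i)) - a\<bar>\<^sup>2) \<partial>Pi\<^sub>M {..<n} (\<lambda>_. Q)) =
    ennreal (((\<integral>x. g x \<partial>Q) - a)\<^sup>2 + ((\<integral>x. (g x)\<^sup>2 \<partial>Q) - (\<integral>x. g x \<partial>Q)\<^sup>2) / real n)"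
proof -
  interpret Q: prob_space Q by fact
  interpret QI: product_sigma_finite "\<lambda>_. Q" by standard
  let ?Q = "Pi\<^sub>M {..<n} (\<lambda>_. Q)"
  interpret QQ: prob_space ?Q
    by (intro prob_space_PiM Q)
  define m where "m = (\<integral>x. g x \<partial>Q)"
  define h where "h x = g x - m" for x
  have g1: "integrable Q g"
    using Q.square_integrable_imp_integrable[OF _ g2] by simp
  have h1: "integrable Q h" and h0: "(\<integral>x. h x \<partial>Q) = 0"
    using g1 by (simp_all add: h_def[abs_def] Q.prob_space m_def)
  have h2: "integrable Q (\<lambda>x. (h x)\<^sup>2)"
    using g1 g2 by (simp add: h_def power2_diff)
  have "(\<integral>x. (h x)\<^sup>2 \<partial>Q) = (\<integral>x. (g x)\<^sup>2 \<partial>Q) + m\<^sup>2 - 2 * (\<integral>x. g x \<partial>Q) * m"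
    using g1 g2 by (simp add: h_def power2_diff Q.prob_space)
  then have hv: "(\<integral>x. (h x)\<^sup>2 \<partial>Q) = (\<integral>x. (g x)\<^sup>2 \<partial>Q) - m\<^sup>2"
    by (simp add: m_def power2_eq_square)
  define v where "v = (\<integral>x. (h x)\<^sup>2 \<partial>Q)"
  have I: "integrable ?Q (\<lambda>x. h (x i) * h (x j)) \<and>
      (\<integral>x. h (x i) * h (x j) \<partial>?Q) = (if i = j then v else 0)"
    if ij: "i < n" "j < n" for i j
  proof (cases "i = j")
    case True
    \<comment> \<open>One factor per coordinate, equal to 1 away from \<open>i\<close>, so that the
      product formula for integrals applies to all \<open>n\<close> coordinates.\<close>
    define u where "u k x = (if k = i then (h x)\<^sup>2 else 1)" for k x
    have u: "integrable Q (u k)" for k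
      using h2 by (cases "k = i") (auto simp: u_def[abs_def])
    have "(\<Prod>k<n. u k (x k)) = h (x i) * h (x j)" for x
    proof -
      have "(\<Prod>k<n. u k (x k)) = (\<Prod>k\<in>{i}. u k (x k))"
        using ij by (intro prod.mono_neutral_right) (auto simp: u_def)
      then show ?thesis
        using True by (simp add: u_def power2_eq_square)
    qed
    moreover have "(\<Prod>k<n. integral\<^sup>L Q (u k)) = (\<Prod>k\<in>{i}. integral\<^sup>L Q (u k))"
      using ij by (intro prod.mono_neutral_right) (auto simp: u_def[abs_def] Q.prob_space)
    moreover have "integral\<^sup>L Q (u i) = v"
      by (simp add: u_def[abs_def] v_def)
    ultimately show ?thesis
      using True QI.product_integrable_prod[of "{..<n}" u] QI.product_integral_prod[of "{..<n}" u] u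
      by simp
  next
    case False
    define u where "u k x = (if k = i \<or> k = j then h x else 1)" for k x
    have u: "integrable Q (u k)" for k
      using h1 by (cases "k = i \<or> k = j") (auto simp: u_def[abs_def])
    have "(\<Prod>k<n. u k (x k)) = h (x i) * h (x j)" for x
    proof -
      have "(\<Prod>k<n. u k (x k)) = (\<Prod>k\<in>{i, j}. u k (x k))"
        using ij by (intro prod.mono_neutral_right) (auto simp: u_def)
      then show ?thesis
        using False by (simp add: u_def)
    qed
    \<comment> \<open>The factor at coordinate \<open>i\<close> is centred, which annihilates the
      whole product.\<close>
    moreover have "(\<Prod>k<n. integral\<^sup>L Q (u k)) = 0"
      using ij h0 by (intro prod_zero bexI[of _ i]) (auto simp: u_def[abs_def])
    ultimately show ?thesis
      using False QI.product_integrable_prod[of "{..<n}" u] QI.product_integral_prod[of "{..<n}" u] u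
      by simp
  qed
  have H1: "integrable ?Q (\<lambda>x. h (x i)) \<and> (\<integral>x. h (x i) \<partial>?Q) = 0" if "i < n" for i
  proof -
    have "distr ?Q Q (\<lambda>x. x i) = Q"
      using that Q by (intro distr_PiM_component) auto
    moreover have "(\<lambda>x. x i) \<in> ?Q \<rightarrow>\<^sub>M Q"
      using that by simp
    ultimately show ?thesis
      using h1 h0 integrable_distr[of "\<lambda>x. x i" ?Q Q h] integral_distr[of "\<lambda>x. x i" ?Q Q h] by simp
  qed
  have eq: "\<bar>1 / real n * (\<Sum>i<n. g (x i)) - a\<bar>\<^sup>2 =
      (\<Sum>i<n. \<Sum>j<n. h (x i) * h (x j)) / (real n)\<^sup>2 + 2 * (m - a) / real n * (\<Sum>i<n. h (x i)) + (m - a)\<^sup>2"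
    for x
  proof -
    have "1 / real n * (\<Sum>i<n. g (x i)) - a = (\<Sum>i<n. h (x i)) / real n + (m - a)"
      using n by (simp add: h_def sum_subtractf field_simps)
    moreover have "(\<Sum>i<n. \<Sum>j<n. h (x i) * h (x j)) = (\<Sum>i<n. h (x i))\<^sup>2"
      by (simp add: power2_eq_square sum_product)
    moreover have "(s / k + d)\<^sup>2 = s\<^sup>2 / k\<^sup>2 + 2 * d / k * s + d\<^sup>2" for s k d :: real
      by (simp add: power2_sum power_divide)
    ultimately show ?thesis
      by (simp only: power2_abs)
  qed
  define D where "D x = (\<Sum>i<n. \<Sum>j<n. h (x i) * h (x j))" for x
  define S where "S x = (\<Sum>i<n. h (x i))" for x
  have D: "integrable ?Q D"
    unfolding D_def[abs_def] by (intro Bochner_Integration.integrable_sum) (use I in auto)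
  have "(\<integral>x. D x \<partial>?Q) = (\<Sum>i<n. \<integral>x. (\<Sum>j<n. h (x i) * h (x j)) \<partial>?Q)"
    unfolding D_def
    by (intro Bochner_Integration.integral_sum Bochner_Integration.integrable_sum) (use I in auto)
  also have "\<dots> = (\<Sum>i<n. \<Sum>j<n. \<integral>x. h (x i) * h (x j) \<partial>?Q)"
    by (intro sum.cong refl Bochner_Integration.integral_sum) (use I in auto)
  also have "\<dots> = (\<Sum>i<n. \<Sum>j<n. if i = j then v else 0)"
    by (intro sum.cong refl) (use I in auto)
  finally have ED: "(\<integral>x. D x \<partial>?Q) = real n * v"
    by (simp add: sum.delta)
  have S: "integrable ?Q S"
    unfolding S_def[abs_def] by (intro Bochner_Integration.integrable_sum) (use H1 in auto)
  have ES: "(\<integral>x. S x \<partial>?Q) = 0"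
    unfolding S_def using H1 by (simp add: Bochner_Integration.integral_sum)
  have eq': "\<bar>1 / real n * (\<Sum>i<n. g (x i)) - a\<bar>\<^sup>2 =
      D x / (real n)\<^sup>2 + 2 * (m - a) / real n * S x + (m - a)\<^sup>2" for x
    unfolding D_def S_def by (rule eq)
  have int: "integrable ?Q (\<lambda>x. \<bar>1 / real n * (\<Sum>i<n. g (x i)) - a\<bar>\<^sup>2)"
    unfolding eq' using D S
    by (intro Bochner_Integration.integrable_add integrable_divide integrable_mult_right) auto
  have "(\<integral>x. \<bar>1 / real n * (\<Sum>i<n. g (x i)) - a\<bar>\<^sup>2 \<partial>?Q) =
      (\<integral>x. D x / (real n)\<^sup>2 \<partial>?Q) + (\<integral>x. 2 * (m - a) / real n * S x \<partial>?Q) + (\<integral>x. (m - a)\<^sup>2 \<partial>?Q)"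
    unfolding eq' using D S
    by (subst Bochner_Integration.integral_add;
        (intro Bochner_Integration.integrable_add integrable_divide integrable_mult_right)?; simp)
  also have "\<dots> = real n * v / (real n)\<^sup>2 + (m - a)\<^sup>2"
    by (simp only: integral_divide_zero integral_mult_right_zero ED ES) (simp add: QQ.prob_space)
  also have "\<dots> = (m - a)\<^sup>2 + v / real n"
    using n by (simp add: power2_eq_square)
  finally show ?thesis
    using int by (simp add: nn_integral_eq_integral m_def v_def hv)
qed

section \<open>Bias and standard deviation as functionals of the prior\<close>

text \<open>The topology on the priors is kept out of the locale: it enters only in
  \<open>lagrangian_uniform\<close> and \<open>linear_estimator\<close>, where compactness is
  used.\<close>

locale mixture_model =
  fixes M :: "'a measure" and N :: "'b measure"
    and P :: "'a \<Rightarrow> 'b measure"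
    and Priors :: "'a measure set"
    and T :: "'a measure \<Rightarrow> real"
    and F :: "('b \<Rightarrow> real) set"
  assumes kernel: "P \<in> M \<rightarrow>\<^sub>M prob_algebra N"
    and priors: "Priors \<subseteq> space (prob_algebra M)"
    and affine: "affine_functional Priors T"
    and convex: "convex_measures Priors"
    and F: "function_space F"
    and const: "\<And>c. (\<lambda>_. c) \<in> F"
    and dense: "\<And>\<pi>. \<pi> \<in> Priors \<Longrightarrow> dense_in_L2 F (bind \<pi> P)"
begin

definition mean :: "'a measure \<Rightarrow> ('b \<Rightarrow> real) \<Rightarrow> real" where
  "mean \<pi> f = (\<integral>x. f x \<partial>bind \<pi> P)"

definition var :: "'a measure \<Rightarrow> ('b \<Rightarrow> real) \<Rightarrow> real" where
  "var \<pi> f = mean \<pi> (\<lambda>x. (f x)\<^sup>2) - (mean \<pi> f)\<^sup>2"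

definition sd :: "'a measure \<Rightarrow> ('b \<Rightarrow> real) \<Rightarrow> real" where
  "sd \<pi> f = sqrt (var \<pi> f)"

lemma prob_space_bind_prior: "\<pi> \<in> Priors \<Longrightarrow> prob_space (bind \<pi> P)"
  using priors kernel by (auto intro: prob_space_bind')

lemma sets_bind_prior: "\<pi> \<in> Priors \<Longrightarrow> sets (bind \<pi> P) = sets N"
  using sets_bind'[OF _ kernel] priors by blast

lemma F_lincomb:
  assumes "f \<in> F" "g \<in> F"
  shows "(\<lambda>x. a * f x + b * g x) \<in> F"
proof -
  have add: "(\<lambda>x. f x + g x) \<in> F" if "f \<in> F" "g \<in> F" for f g
    using F that by (simp add: function_space_def)
  show ?thesis
    by (rule add) (use F assms in \<open>auto simp: function_space_def\<close>)
qed

context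
  fixes \<pi> f
  assumes \<pi>: "\<pi> \<in> Priors" and f: "f \<in> F"
begin

lemma F_measurable: "f \<in> borel_measurable N"
  using dense[OF \<pi>] f sets_bind_prior[OF \<pi>]
  by (auto simp: dense_in_L2_def L2_def cong: measurable_cong_sets)

lemma F_measurable_bind: "f \<in> borel_measurable (bind \<pi> P)"
  using dense[OF \<pi>] f by (auto simp: dense_in_L2_def L2_def)

lemma F_square_integrable: "integrable (bind \<pi> P) (\<lambda>x. (f x)\<^sup>2)"
  using dense[OF \<pi>] f by (auto simp: dense_in_L2_def L2_def)

lemma F_integrable: "integrable (bind \<pi> P) f"
proof -
  interpret prob_space "bind \<pi> P"
    by (rule prob_space_bind_prior[OF \<pi>])
  show ?thesis
    using square_integrable_imp_integrable[OF F_measurable_bind F_square_integrable] .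
qed

lemma var_nonneg: "0 \<le> var \<pi> f"
proof -
  interpret prob_space "bind \<pi> P"
    by (rule prob_space_bind_prior[OF \<pi>])
  show ?thesis
    using variance_eq[OF F_integrable F_square_integrable] variance_positive[of f]
    by (simp add: var_def mean_def)
qed

lemma sd_nonneg: "0 \<le> sd \<pi> f"
  using var_nonneg by (simp add: sd_def)

lemma sd_power2: "(sd \<pi> f)\<^sup>2 = var \<pi> f"
  using var_nonneg by (simp add: sd_def)

lemma mean_add_const: "mean \<pi> (\<lambda>x. f x + c) = mean \<pi> f + c"
proof -
  interpret prob_space "bind \<pi> P"
    by (rule prob_space_bind_prior[OF \<pi>])
  show ?thesis
    using F_integrable by (simp add: mean_def prob_space)
qed

lemma var_add_const: "var \<pi> (\<lambda>x. f x + c) = var \<pi> f"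
proof -
  interpret prob_space "bind \<pi> P"
    by (rule prob_space_bind_prior[OF \<pi>])
  have "mean \<pi> (\<lambda>x. (f x + c)\<^sup>2) = mean \<pi> (\<lambda>x. (f x)\<^sup>2) + c\<^sup>2 + 2 * mean \<pi> f * c"
    using F_integrable F_square_integrable by (simp add: mean_def power2_sum prob_space)
  then show ?thesis
    by (simp add: var_def mean_add_const power2_sum)
qed

lemma sd_add_const: "sd \<pi> (\<lambda>x. f x + c) = sd \<pi> f"
  by (simp add: sd_def var_add_const)

end

lemma mean_scale: "mean \<pi> (\<lambda>x. c * f x) = c * mean \<pi> f"
  by (simp add: mean_def)

lemma var_scale: "var \<pi> (\<lambda>x. c * f x) = c\<^sup>2 * var \<pi> f"
  by (simp add: var_def mean_scale power_mult_distrib right_diff_distrib)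

lemma sd_scale: "sd \<pi> (\<lambda>x. c * f x) = \<bar>c\<bar> * sd \<pi> f"
  by (simp add: sd_def var_scale real_sqrt_mult)

section \<open>Linear combinations of functions and convexity of the standard deviation\<close>

lemma
  assumes \<pi>: "\<pi> \<in> Priors" and f: "f \<in> F" and g: "g \<in> F"
  shows mean_lincomb: "mean \<pi> (\<lambda>x. a * f x + b * g x) = a * mean \<pi> f + b * mean \<pi> g"
    and var_lincomb: "var \<pi> (\<lambda>x. a * f x + b * g x) = a\<^sup>2 * var \<pi> f + b\<^sup>2 * var \<pi> g +
      2 * a * b * (mean \<pi> (\<lambda>x. f x * g x) - mean \<pi> f * mean \<pi> g)"
proof -
  note I = F_integrable[OF \<pi> f] F_integrable[OF \<pi> g]
    F_square_integrable[OF \<pi> f] F_square_integrable[OF \<pi> g]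
  have fg: "integrable (bind \<pi> P) (\<lambda>x. f x * g x)"
    using F_measurable_bind[OF \<pi> f] F_measurable_bind[OF \<pi> g] I(3,4)
    by (rule integrable_mult_of_square_integrable)
  show m: "mean \<pi> (\<lambda>x. a * f x + b * g x) = a * mean \<pi> f + b * mean \<pi> g"
    using I by (simp add: mean_def)
  have "(a * f x + b * g x)\<^sup>2 = a\<^sup>2 * (f x)\<^sup>2 + b\<^sup>2 * (g x)\<^sup>2 + 2 * a * b * (f x * g x)" for x
    by (simp add: power2_eq_square algebra_simps)
  then have "mean \<pi> (\<lambda>x. (a * f x + b * g x)\<^sup>2) =
      a\<^sup>2 * mean \<pi> (\<lambda>x. (f x)\<^sup>2) + b\<^sup>2 * mean \<pi> (\<lambda>x. (g x)\<^sup>2) + 2 * a * b * mean \<pi> (\<lambda>x. f x * g x)"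
    using I fg by (simp add: mean_def)
  then show "var \<pi> (\<lambda>x. a * f x + b * g x) = a\<^sup>2 * var \<pi> f + b\<^sup>2 * var \<pi> g +
      2 * a * b * (mean \<pi> (\<lambda>x. f x * g x) - mean \<pi> f * mean \<pi> g)"
    unfolding var_def m by (simp add: power2_eq_square algebra_simps)
qed

text \<open>Minkowski's inequality for centred functions. The Cauchy-Schwarz bound on the covariance
  \<open>c\<close> comes from nonnegativity of the variance of every linear combination. With
  weights summing to 1 this is convexity of \<open>sd\<close> in the function.\<close>

lemma sd_lincomb_le:
  assumes \<pi>: "\<pi> \<in> Priors" and f: "f \<in> F" and g: "g \<in> F" and ab: "0 \<le> a" "0 \<le> b"
  shows "sd \<pi> (\<lambda>x. a * f x + b * g x) \<le> a * sd \<pi> f + b * sd \<pi> g"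
proof -
  define c where "c = mean \<pi> (\<lambda>x. f x * g x) - mean \<pi> f * mean \<pi> g"
  have quad: "0 \<le> s\<^sup>2 * var \<pi> f + t\<^sup>2 * var \<pi> g + 2 * s * t * c" for s t
    using var_nonneg[OF \<pi> F_lincomb[OF f g, of s t]] var_lincomb[OF \<pi> f g, of s t]
    by (simp add: c_def)
  have "c\<^sup>2 \<le> var \<pi> f * var \<pi> g"
  \<comment> \<open>In the degenerate case the quadratic form is affine in \<open>t\<close> for
    \<open>s = 1\<close>, so a nonzero \<open>c\<close> would make it negative for a suitable
    \<open>t\<close>.\<close>
  proof (cases "var \<pi> g = 0")
    case True
    have "c = 0"
    proof (rule ccontr)
      assume "c \<noteq> 0"
      then have "- (var \<pi> f + 1) / c * c = - (var \<pi> f + 1)"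
        by simp
      with quad[of 1 "- (var \<pi> f + 1) / c"] True var_nonneg[OF \<pi> f] \<open>c \<noteq> 0\<close> show False
        by simp
    qed
    with True show ?thesis
      by simp
  next
    case False
    with var_nonneg[OF \<pi> g] have pos: "0 < var \<pi> g"
      by simp
    \<comment> \<open>The ratio of the coefficients \<open>s = var \<pi> g\<close> and
      \<open>t = - c\<close> is that of the minimiser; the scaling avoids a division.\<close>
    have "0 \<le> (var \<pi> g)\<^sup>2 * var \<pi> f + (- c)\<^sup>2 * var \<pi> g + 2 * var \<pi> g * (- c) * c"
      by (rule quad)
    also have "\<dots> = var \<pi> g * (var \<pi> f * var \<pi> g - c\<^sup>2)"
      by (simp add: power2_eq_square algebra_simps)
    finally show ?thesis
      using pos by (simp add: zero_le_mult_iff)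
  qed
  then have "c\<^sup>2 \<le> (sd \<pi> f * sd \<pi> g)\<^sup>2"
    by (simp add: power_mult_distrib sd_power2[OF \<pi> f] sd_power2[OF \<pi> g])
  then have c: "c \<le> sd \<pi> f * sd \<pi> g"
    by (rule power2_le_imp_le) (simp add: sd_nonneg \<pi> f g)
  have "(sd \<pi> (\<lambda>x. a * f x + b * g x))\<^sup>2 = a\<^sup>2 * (sd \<pi> f)\<^sup>2 + b\<^sup>2 * (sd \<pi> g)\<^sup>2 + 2 * a * b * c"
    by (simp add: sd_power2[OF \<pi>] F_lincomb f g var_lincomb[OF \<pi> f g] c_def)
  also have "\<dots> \<le> a\<^sup>2 * (sd \<pi> f)\<^sup>2 + b\<^sup>2 * (sd \<pi> g)\<^sup>2 + 2 * a * b * (sd \<pi> f * sd \<pi> g)"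
    using c ab by (intro add_left_mono mult_left_mono) auto
  also have "\<dots> = (a * sd \<pi> f + b * sd \<pi> g)\<^sup>2"
    by (simp add: power2_eq_square algebra_simps)
  finally show ?thesis
    by (rule power2_le_imp_le) (simp add: ab sd_nonneg \<pi> f g)
qed

section \<open>Behaviour under convex combinations of priors\<close>

context
  fixes \<pi> \<pi>' :: "'a measure" and l :: real
  assumes \<pi>: "\<pi> \<in> Priors" and \<pi>': "\<pi>' \<in> Priors" and l: "0 \<le> l" "l \<le> 1"
begin

lemma mixture_in_Priors: "mixture l \<pi> \<pi>' \<in> Priors"
  using convex \<pi> \<pi>' l by (auto simp: convex_measures_def)

lemma T_mixture: "T (mixture l \<pi> \<pi>') = (1 - l) * T \<pi> + l * T \<pi>'"
  using affine \<pi> \<pi>' l mixture_in_Priors by (auto simp: affine_functional_def)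

lemma bind_mixture_prior: "bind (mixture l \<pi> \<pi>') P = mixture l (bind \<pi> P) (bind \<pi>' P)"
  using priors \<pi> \<pi>' kernel by (auto intro: bind_mixture)

lemma mean_mixture:
  assumes "integrable (bind \<pi> P) f" "integrable (bind \<pi>' P) f"
  shows "mean (mixture l \<pi> \<pi>') f = (1 - l) * mean \<pi> f + l * mean \<pi>' f"
  unfolding mean_def bind_mixture_prior
  using l assms by (intro integral_mixture) (auto simp: sets_bind_prior \<pi> \<pi>')

text \<open>The law of total variance: the last term is the variance between the two
  components.\<close>

lemma var_mixture:
  assumes f: "f \<in> F"
  shows "var (mixture l \<pi> \<pi>') f =
    (1 - l) * var \<pi> f + l * var \<pi>' f + l * (1 - l) * (mean \<pi> f - mean \<pi>' f)\<^sup>2"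
  unfolding var_def mean_mixture[OF F_integrable[OF \<pi> f] F_integrable[OF \<pi>' f]]
    mean_mixture[OF F_square_integrable[OF \<pi> f] F_square_integrable[OF \<pi>' f]]
  by (simp add: power2_eq_square algebra_simps)

text \<open>Two losses have the right sign: the variance between the components is dropped, and the
  square root is concave. This is the concavity in the prior that Fan's theorem requires.\<close>

lemma sd_mixture_ge:
  assumes f: "f \<in> F"
  shows "(1 - l) * sd \<pi> f + l * sd \<pi>' f \<le> sd (mixture l \<pi> \<pi>') f"
proof (rule power2_le_imp_le)
  have "((1 - l) * sd \<pi> f + l * sd \<pi>' f)\<^sup>2 =
      (1 - l) * (sd \<pi> f)\<^sup>2 + l * (sd \<pi>' f)\<^sup>2 - l * (1 - l) * (sd \<pi> f - sd \<pi>' f)\<^sup>2"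
    by (simp add: power2_eq_square algebra_simps)
  also have "\<dots> \<le> (1 - l) * (sd \<pi> f)\<^sup>2 + l * (sd \<pi>' f)\<^sup>2"
    using l by simp
  also have "\<dots> \<le> (1 - l) * (sd \<pi> f)\<^sup>2 + l * (sd \<pi>' f)\<^sup>2 + l * (1 - l) * (mean \<pi> f - mean \<pi>' f)\<^sup>2"
    using l by simp
  also have "\<dots> = (1 - l) * var \<pi> f + l * var \<pi>' f + l * (1 - l) * (mean \<pi> f - mean \<pi>' f)\<^sup>2"
    by (simp add: sd_power2 \<pi> \<pi>' f)
  finally show "((1 - l) * sd \<pi> f + l * sd \<pi>' f)\<^sup>2 \<le> (sd (mixture l \<pi> \<pi>') f)\<^sup>2"
    by (simp add: sd_power2[OF mixture_in_Priors f] var_mixture[OF f])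
  show "0 \<le> sd (mixture l \<pi> \<pi>') f"
    by (rule sd_nonneg[OF mixture_in_Priors f])
qed

end

section \<open>The modulus of continuity\<close>

text \<open>The pair tested in the modulus is \<open>\<pi>\<close> against the mixture
  \<open>q\<close>, not against \<open>\<pi>'\<close>. Since \<open>q\<close> keeps weight
  \<open>1 - l\<close> on \<open>\<pi>\<close>, it dominates \<open>\<pi>\<close> with constant
  \<open>1 / (1 - l)\<close>. The differences of means and of \<open>T\<close> both shrink by the
  factor \<open>l\<close>, so \<open>var\<close> is the variational form of the chi-squared
  bound.\<close>

lemma modulus_ge_mixture:
  assumes \<pi>: "\<pi> \<in> Priors" and \<pi>': "\<pi>' \<in> Priors" and l: "0 \<le> l" "l < 1"
    and var: "\<And>f. f \<in> F \<Longrightarrow> l\<^sup>2 * (mean \<pi> f - mean \<pi>' f)\<^sup>2 \<le> t\<^sup>2 * var (mixture l \<pi> \<pi>') f"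
  shows "ennreal (l * (T \<pi> - T \<pi>')) \<le> chi2_modulus P Priors T t"
proof -
  define q where "q = mixture l \<pi> \<pi>'"
  have l': "0 \<le> l" "l \<le> 1"
    using l by auto
  have q: "q \<in> Priors"
    unfolding q_def by (rule mixture_in_Priors[OF \<pi> \<pi>' l'])
  have bq: "bind q P = mixture l (bind \<pi> P) (bind \<pi>' P)"
    unfolding q_def by (rule bind_mixture_prior[OF \<pi> \<pi>' l'])
  have "chi2_divergence (bind \<pi> P) (bind q P) \<le> ennreal (t\<^sup>2)"
  proof (rule chi2_divergence_le)
    show "prob_space (bind q P)" "prob_space (bind \<pi> P)" "dense_in_L2 F (bind q P)"
      using q \<pi> prob_space_bind_prior dense by auto
    show "sets (bind \<pi> P) = sets (bind q P)"
      using q \<pi> by (simp add: sets_bind_prior)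
    show "0 \<le> t\<^sup>2"
      by simp
    fix f :: "'b \<Rightarrow> ennreal"
    assume "f \<in> borel_measurable (bind q P)"
    then have "f \<in> borel_measurable (bind \<pi> P)"
      using q \<pi> by (simp add: sets_bind_prior cong: measurable_cong_sets)
    then have "ennreal (1 - l) * (\<integral>\<^sup>+x. f x \<partial>bind \<pi> P) \<le> (\<integral>\<^sup>+x. f x \<partial>bind q P)"
      unfolding bq by (subst nn_integral_mixture) (auto simp: sets_bind_prior \<pi> \<pi>')
    then have "ennreal (1 / (1 - l)) * (ennreal (1 - l) * (\<integral>\<^sup>+x. f x \<partial>bind \<pi> P)) \<le>
        ennreal (1 / (1 - l)) * (\<integral>\<^sup>+x. f x \<partial>bind q P)"
      by (rule mult_left_mono) simp
    then show "(\<integral>\<^sup>+x. f x \<partial>bind \<pi> P) \<le> ennreal (1 / (1 - l)) * (\<integral>\<^sup>+x. f x \<partial>bind q P)"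
      using l by (simp add: mult.assoc[symmetric] flip: ennreal_mult)
  next
    fix f
    assume f: "f \<in> F"
    have "mean \<pi> f - mean q f = l * (mean \<pi> f - mean \<pi>' f)"
      unfolding q_def mean_mixture[OF \<pi> \<pi>' l' F_integrable[OF \<pi> f] F_integrable[OF \<pi>' f]]
      by (simp add: algebra_simps)
    then have "(mean \<pi> f - mean q f)\<^sup>2 \<le> t\<^sup>2 * var q f"
      using var[OF f] by (simp add: power_mult_distrib q_def)
    also have "\<dots> \<le> t\<^sup>2 * mean q (\<lambda>x. (f x)\<^sup>2)"
      by (intro mult_left_mono) (auto simp: var_def)
    finally show "((\<integral>x. f x \<partial>bind \<pi> P) - (\<integral>x. f x \<partial>bind q P))\<^sup>2 \<le> t\<^sup>2 * (\<integral>x. (f x)\<^sup>2 \<partial>bind q P)"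
      by (simp add: mean_def)
  qed
  then have "ennreal (T \<pi> - T q) \<le> chi2_modulus P Priors T t"
    unfolding chi2_modulus_def using \<pi> q by (intro Sup_upper) auto
  also have "T \<pi> - T q = l * (T \<pi> - T \<pi>')"
    unfolding q_def T_mixture[OF \<pi> \<pi>' l'] by (simp add: algebra_simps)
  finally show ?thesis .
qed

text \<open>Settles the degenerate case, since the minimax argument needs a positive modulus. A
  small enough weight on \<open>\<pi>'\<close> brings any two priors within the divergence bound, so
  a zero modulus forces \<open>T\<close> to be constant.\<close>

lemma constant_if_modulus_0:
  assumes \<pi>: "\<pi> \<in> Priors" and \<pi>': "\<pi>' \<in> Priors" and t: "t \<noteq> 0"
    and 0: "chi2_modulus P Priors T t = 0"
  shows "T \<pi> \<le> T \<pi>'"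
proof -
  \<comment> \<open>Chosen so that \<open>t\<^sup>2 * (1 - l) = l\<close>: the variance between the
    components alone then gives the required bound.\<close>
  define l where "l = t\<^sup>2 / (1 + t\<^sup>2)"
  have p: "0 < 1 + t\<^sup>2"
    by (simp add: add_pos_nonneg)
  have l: "0 < l" "l < 1" and l1: "t\<^sup>2 * (1 - l) = l"
    using t p by (auto simp: l_def field_simps)
  have "ennreal (l * (T \<pi> - T \<pi>')) \<le> chi2_modulus P Priors T t"
  proof (rule modulus_ge_mixture[OF \<pi> \<pi>'])
    fix f
    assume f: "f \<in> F"
    have "l\<^sup>2 * (mean \<pi> f - mean \<pi>' f)\<^sup>2 = l * (t\<^sup>2 * (1 - l)) * (mean \<pi> f - mean \<pi>' f)\<^sup>2"
      unfolding l1 by (simp add: power2_eq_square)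
    also have "\<dots> = t\<^sup>2 * (l * (1 - l) * (mean \<pi> f - mean \<pi>' f)\<^sup>2)"
      by (simp only: ac_simps)
    also have "\<dots> \<le> t\<^sup>2 * var (mixture l \<pi> \<pi>') f"
      using l var_nonneg[OF \<pi> f] var_nonneg[OF \<pi>' f]
      by (intro mult_left_mono) (auto simp: var_mixture[OF \<pi> \<pi>' _ _ f])
    finally show "l\<^sup>2 * (mean \<pi> f - mean \<pi>' f)\<^sup>2 \<le> t\<^sup>2 * var (mixture l \<pi> \<pi>') f" .
  qed (use l in auto)
  with 0 l show ?thesis
    by (auto simp: ennreal_eq_0_iff mult_le_0_iff)
qed

text \<open>The weight \<open>l = (n + 1) / (2 n + 1)\<close> solves \<open>n l = (n + 1) (1 - l)\<close>.  Since it exceeds 1/2, the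
  resulting bound is strictly better than \<open>T \<pi> - T \<pi>' \<le> 2 \<delta>\<close>, which is what makes
  the infimum over linear estimators attained.\<close>

lemma modulus_ge_pair:
  assumes \<pi>: "\<pi> \<in> Priors" and \<pi>': "\<pi>' \<in> Priors" and n: "n \<ge> 1"
    and sep: "\<And>f. f \<in> F \<Longrightarrow> real n * (mean \<pi> f - mean \<pi>' f)\<^sup>2 \<le> (sd \<pi> f + sd \<pi>' f)\<^sup>2"
  shows "ennreal ((real n + 1) / (2 * real n + 1) * (T \<pi> - T \<pi>'))
    \<le> chi2_modulus P Priors T (1 / sqrt (real n))"
proof (rule modulus_ge_mixture[OF \<pi> \<pi>'])
  define l where "l = (real n + 1) / (2 * real n + 1)"
  have l: "0 \<le> l" "l \<le> 1" and nl: "real n * l = (real n + 1) * (1 - l)"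
    by (auto simp: l_def field_simps)
  show "0 \<le> (real n + 1) / (2 * real n + 1)" "(real n + 1) / (2 * real n + 1) < 1"
    using n by auto
  fix f
  assume f: "f \<in> F"
  let ?w = "(mean \<pi> f - mean \<pi>' f)\<^sup>2" and ?a = "sd \<pi> f" and ?b = "sd \<pi>' f"
  have "real n * (l\<^sup>2 * ?w) = l * (1 - l) * (real n * ?w) + l * (1 - l) * ?w"
    using arg_cong[OF nl, of "\<lambda>x. l * x * ?w"] by (simp add: power2_eq_square algebra_simps)
  also have "\<dots> \<le> l * (1 - l) * (?a + ?b)\<^sup>2 + l * (1 - l) * ?w"
    using sep[OF f] l by (intro add_right_mono mult_left_mono) auto
  \<comment> \<open>Discarding the subtracted square leaves exactly the variance within the
    components of the mixture.\<close>
  also have "l * (1 - l) * (?a + ?b)\<^sup>2 = (1 - l) * ?a\<^sup>2 + l * ?b\<^sup>2 - ((1 - l) * ?a - l * ?b)\<^sup>2"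
    by (simp add: power2_eq_square algebra_simps)
  also have "\<dots> + l * (1 - l) * ?w \<le> (1 - l) * ?a\<^sup>2 + l * ?b\<^sup>2 + l * (1 - l) * ?w"
    by simp
  also have "\<dots> = var (mixture l \<pi> \<pi>') f"
    using l by (simp add: var_mixture[OF \<pi> \<pi>' _ _ f] sd_power2 \<pi> \<pi>' f)
  finally have "l\<^sup>2 * ?w \<le> (1 / sqrt (real n))\<^sup>2 * var (mixture l \<pi> \<pi>') f"
    using n by (simp add: power_divide field_simps)
  then show "((real n + 1) / (2 * real n + 1))\<^sup>2 * ?w \<le>
      (1 / sqrt (real n))\<^sup>2 * var (mixture ((real n + 1) / (2 * real n + 1)) \<pi> \<pi>') f"
    by (simp add: l_def)
qed

section \<open>The upper bound\<close>

text \<open>The sum of an underestimation error at the first prior and an overestimation error at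
  the second, each being a signed bias plus \<open>sd / sqrt n\<close>. Adding a constant to
  \<open>f\<close> does not change it, so the constant can be chosen last.\<close>

definition lagrangian :: "nat \<Rightarrow> 'a measure \<times> 'a measure \<Rightarrow> ('b \<Rightarrow> real) \<Rightarrow> real" where
  "lagrangian n p f = T (fst p) - T (snd p) - (mean (fst p) f - mean (snd p) f) +
     (sd (fst p) f + sd (snd p) f) / sqrt (real n)"

text \<open>Either no function separates the two priors, and the modulus bounds
  \<open>T \<pi> - T \<pi>'\<close> so that the zero function works; or some function has a gap of
  means exceeding its noise, and a multiple of it compensates the gap of \<open>T\<close>.\<close>

lemma lagrangian_pointwise:
  assumes \<pi>: "\<pi> \<in> Priors" and \<pi>': "\<pi>' \<in> Priors" and n: "n \<ge> 1"
    and d: "chi2_modulus P Priors T (1 / sqrt (real n)) = ennreal d" "0 < d"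
  shows "\<exists>f\<in>F. lagrangian n (\<pi>, \<pi>') f < 2 * d"
proof (cases "\<forall>f\<in>F. real n * (mean \<pi> f - mean \<pi>' f)\<^sup>2 \<le> (sd \<pi> f + sd \<pi>' f)\<^sup>2")
  case True
  define l where "l = (real n + 1) / (2 * real n + 1)"
  have l: "1 < 2 * l"
    by (simp add: l_def field_simps)
  define D where "D = T \<pi> - T \<pi>'"
  have "l * D \<le> d"
    using modulus_ge_pair[OF \<pi> \<pi>' n] True d by (simp add: l_def D_def)
  moreover have "D < 2 * (l * D)" if "0 < D"
    using mult_strict_right_mono[OF l that] by (simp only: mult_1 mult.assoc)
  ultimately have "D < 2 * d"
    using d(2) by (cases "0 < D") linarith+
  then have "T \<pi> - T \<pi>' < 2 * d"
    by (simp add: D_def)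
  then have "lagrangian n (\<pi>, \<pi>') (\<lambda>_. 0) < 2 * d"
    by (simp add: lagrangian_def sd_def var_def mean_def)
  with const[of 0] show ?thesis
    by blast
next
  case False
  then obtain f where f: "f \<in> F"
    and w: "(sd \<pi> f + sd \<pi>' f)\<^sup>2 < real n * (mean \<pi> f - mean \<pi>' f)\<^sup>2"
    by (auto simp: not_le)
  define w where "w = mean \<pi> f - mean \<pi>' f"
  define s where "s = (sd \<pi> f + sd \<pi>' f) / sqrt (real n)"
  have s: "0 \<le> s"
    using n by (simp add: s_def sd_nonneg \<pi> \<pi>' f)
  have "s\<^sup>2 < \<bar>w\<bar>\<^sup>2"
    using w n by (simp add: s_def w_def power_divide field_simps)
  then have sw: "s < \<bar>w\<bar>"
    by (rule power2_less_imp_less) simp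
  \<comment> \<open>The sign makes \<open>c * w\<close> positive or zero; the size makes the net
    gain \<open>\<bar>c\<bar> * (\<bar>w\<bar> - s)\<close> equal to
    \<open>\<bar>T \<pi> - T \<pi>'\<bar>\<close>.\<close>
  define c where "c = sgn w * \<bar>T \<pi> - T \<pi>'\<bar> / (\<bar>w\<bar> - s)"
  have "\<bar>sgn w\<bar> = 1"
    using sw s by (simp add: abs_sgn_eq)
  then have c: "\<bar>c\<bar> = \<bar>T \<pi> - T \<pi>'\<bar> / (\<bar>w\<bar> - s)"
    using sw by (simp add: c_def abs_mult)
  have "sgn w * w = \<bar>w\<bar>"
    by (metis abs_sgn mult.commute)
  moreover have "c * w = \<bar>c\<bar> * (sgn w * w)"
    unfolding c by (simp add: c_def)
  ultimately have cw: "c * w = \<bar>c\<bar> * \<bar>w\<bar>"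
    by (simp only:)
  have "lagrangian n (\<pi>, \<pi>') (\<lambda>x. c * f x) = T \<pi> - T \<pi>' - c * w + \<bar>c\<bar> * s"
    by (simp add: lagrangian_def mean_scale sd_scale w_def s_def algebra_simps)
  also have "\<dots> = T \<pi> - T \<pi>' - \<bar>c\<bar> * (\<bar>w\<bar> - s)"
    by (simp add: cw algebra_simps)
  also have "\<bar>c\<bar> * (\<bar>w\<bar> - s) = \<bar>T \<pi> - T \<pi>'\<bar>"
    using sw by (simp add: c)
  also have "T \<pi> - T \<pi>' - \<bar>T \<pi> - T \<pi>'\<bar> < 2 * d"
    using d by simp
  finally show ?thesis
    using F f by (auto simp: function_space_def intro!: bexI[of _ "\<lambda>x. c * f x"])
qed

text \<open>Fan's theorem on the compact space of pairs of priors. Affinity of \<open>T\<close> and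
  linearity of the mean leave only \<open>sd\<close> to check, which is concave in the prior and
  convex in the function.\<close>

lemma lagrangian_uniform:
  assumes top: "topspace \<tau> = Priors" and comp: "compact_space \<tau>"
    and contT: "continuous_map \<tau> euclideanreal T"
    and cont1: "\<And>f. f \<in> F \<Longrightarrow> continuous_map \<tau> euclideanreal (\<lambda>\<pi>. mean \<pi> f)"
    and cont2: "\<And>f. f \<in> F \<Longrightarrow> continuous_map \<tau> euclideanreal (\<lambda>\<pi>. mean \<pi> (\<lambda>x. (f x)\<^sup>2))"
    and n: "n \<ge> 1"
    and d: "chi2_modulus P Priors T (1 / sqrt (real n)) = ennreal d" "0 < d"
  shows "\<exists>f\<in>F. \<forall>\<pi>\<in>Priors. \<forall>\<pi>'\<in>Priors. lagrangian n (\<pi>, \<pi>') f \<le> 2 * d"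
proof -
  let ?\<tau> = "prod_topology \<tau> \<tau>"
  have "\<exists>f\<in>F. \<forall>p\<in>topspace ?\<tau>. lagrangian n p f \<le> 2 * d"
  proof (rule fan_minimax)
    show "compact_space ?\<tau>"
      using comp by (simp add: compact_space_prod_topology)
    show "F \<noteq> {}"
      using const by auto
    show "\<exists>f\<in>F. lagrangian n p f < 2 * d" if "p \<in> topspace ?\<tau>" for p
      using that lagrangian_pointwise[OF _ _ n d, of "fst p" "snd p"] by (auto simp: top)
    show "closedin ?\<tau> {p \<in> topspace ?\<tau>. 2 * d \<le> lagrangian n p f}" if f: "f \<in> F" for f
    proof -
      have fst: "continuous_map ?\<tau> euclideanreal (\<lambda>p. u (fst p))"
        and snd: "continuous_map ?\<tau> euclideanreal (\<lambda>p. u (snd p))"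
        if "continuous_map \<tau> euclideanreal u" for u
        using continuous_map_compose[OF continuous_map_fst that]
          continuous_map_compose[OF continuous_map_snd that] by (auto simp: o_def)
      have sd: "continuous_map \<tau> euclideanreal (\<lambda>\<pi>. sd \<pi> f)"
        unfolding sd_def var_def using cont1[OF f] cont2[OF f]
        by (intro continuous_map_sqrt continuous_map_diff continuous_map_real_pow)
      have "continuous_map ?\<tau> euclideanreal (\<lambda>p. lagrangian n p f)"
        unfolding lagrangian_def
        using n fst[OF contT] snd[OF contT] fst[OF cont1[OF f]] snd[OF cont1[OF f]] fst[OF sd] snd[OF sd]
        by (intro continuous_map_add continuous_map_diff continuous_map_real_divide) auto
      then have "closedin ?\<tau> {p \<in> topspace ?\<tau>. lagrangian n p f \<in> {2 * d..}}"
        by (rule closedin_continuous_map_preimage) simp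
      then show ?thesis
        by simp
    qed
    show "\<exists>z\<in>topspace ?\<tau>. \<forall>f\<in>F. (1 - l) * lagrangian n p f + l * lagrangian n q f \<le> lagrangian n z f"
      if "p \<in> topspace ?\<tau>" "q \<in> topspace ?\<tau>" and l: "0 \<le> l" "l \<le> 1" for p q and l :: real
    proof -
      obtain p1 p2 q1 q2 where pq: "p = (p1, p2)" "q = (q1, q2)"
        by (metis surj_pair)
      have in_Priors: "p1 \<in> Priors" "p2 \<in> Priors" "q1 \<in> Priors" "q2 \<in> Priors"
        using that by (auto simp: pq top)
      let ?z = "(mixture l p1 q1, mixture l p2 q2)"
      have "?z \<in> topspace ?\<tau>"
        using in_Priors l by (simp add: top mixture_in_Priors)
      moreover have "(1 - l) * lagrangian n p f + l * lagrangian n q f \<le> lagrangian n ?z f"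
        if f: "f \<in> F" for f
      proof -
        have "((1 - l) * sd p1 f + l * sd q1 f + ((1 - l) * sd p2 f + l * sd q2 f)) / sqrt (real n) \<le>
            (sd (mixture l p1 q1) f + sd (mixture l p2 q2) f) / sqrt (real n)"
          using in_Priors l f by (intro divide_right_mono add_mono sd_mixture_ge) auto
        moreover have "(1 - l) * lagrangian n p f + l * lagrangian n q f =
            T (mixture l p1 q1) - T (mixture l p2 q2) -
            (mean (mixture l p1 q1) f - mean (mixture l p2 q2) f) +
            ((1 - l) * sd p1 f + l * sd q1 f + ((1 - l) * sd p2 f + l * sd q2 f)) / sqrt (real n)"
          using in_Priors l f
          by (simp add: lagrangian_def pq T_mixture mean_mixture F_integrable algebra_simps
              add_divide_distrib diff_divide_distrib)
        ultimately show ?thesis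
          by (simp add: lagrangian_def)
      qed
      ultimately show ?thesis
        by blast
    qed
    show "\<exists>k\<in>F. \<forall>p. p \<in> topspace ?\<tau> \<longrightarrow>
        lagrangian n p k \<le> (1 - l) * lagrangian n p g + l * lagrangian n p h"
      if g: "g \<in> F" and h: "h \<in> F" and l: "0 \<le> l" "l \<le> 1" for g h and l :: real
    proof -
      let ?k = "\<lambda>x. (1 - l) * g x + l * h x"
      have "lagrangian n p ?k \<le> (1 - l) * lagrangian n p g + l * lagrangian n p h"
        if "p \<in> topspace ?\<tau>" for p
      proof -
        obtain p1 p2 where p: "p = (p1, p2)"
          by (metis surj_pair)
        have in_Priors: "p1 \<in> Priors" "p2 \<in> Priors"
          using that by (auto simp: p top)
        have "(sd p1 ?k + sd p2 ?k) / sqrt (real n) \<le>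
            ((1 - l) * sd p1 g + l * sd p1 h + ((1 - l) * sd p2 g + l * sd p2 h)) / sqrt (real n)"
          using in_Priors l g h by (intro divide_right_mono add_mono sd_lincomb_le) auto
        moreover have m: "mean p1 ?k = (1 - l) * mean p1 g + l * mean p1 h"
          "mean p2 ?k = (1 - l) * mean p2 g + l * mean p2 h"
          using in_Priors g h by (simp_all only: mean_lincomb)
        have "(1 - l) * lagrangian n p g + l * lagrangian n p h =
            T p1 - T p2 - (mean p1 ?k - mean p2 ?k) +
            ((1 - l) * sd p1 g + l * sd p1 h + ((1 - l) * sd p2 g + l * sd p2 h)) / sqrt (real n)"
          unfolding lagrangian_def p fst_conv snd_conv m
          by (simp add: algebra_simps add_divide_distrib diff_divide_distrib)
        ultimately show ?thesis
          by (simp add: lagrangian_def p)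
      qed
      with F_lincomb[OF g h] show ?thesis
        by blast
    qed
  qed
  then show ?thesis
    by (auto simp: top)
qed

text \<open>The bound on \<open>lagrangian\<close> decouples into
  \<open>A \<pi> + B \<pi>' \<le> 2 * d\<close>, where \<open>A\<close> and \<open>B\<close> are the
  two one-sided errors. An additive constant lowers one and raises the other, so both can be brought
  to at most \<open>d\<close>.\<close>

lemma linear_estimator:
  assumes top: "topspace \<tau> = Priors" and comp: "compact_space \<tau>"
    and contT: "continuous_map \<tau> euclideanreal T"
    and cont1: "\<And>f. f \<in> F \<Longrightarrow> continuous_map \<tau> euclideanreal (\<lambda>\<pi>. mean \<pi> f)"
    and cont2: "\<And>f. f \<in> F \<Longrightarrow> continuous_map \<tau> euclideanreal (\<lambda>\<pi>. mean \<pi> (\<lambda>x. (f x)\<^sup>2))"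
    and n: "n \<ge> 1"
    and d: "chi2_modulus P Priors T (1 / sqrt (real n)) = ennreal d" "0 \<le> d"
  shows "\<exists>f\<in>F. \<forall>\<pi>\<in>Priors. \<bar>mean \<pi> f - T \<pi>\<bar> + sd \<pi> f / sqrt (real n) \<le> d"
proof (cases "d = 0 \<or> Priors = {}")
  case True
  have eq: "T \<pi> = T \<pi>'" if "\<pi> \<in> Priors" "\<pi>' \<in> Priors" for \<pi> \<pi>'
    by (rule antisym; rule constant_if_modulus_0[of _ _ "1 / sqrt (real n)"])
      (use that True d n in auto)
  \<comment> \<open>Here \<open>T\<close> is constant on the priors, so its value at any prior is an
    exact estimator; without priors the arbitrary value is harmless.\<close>
  define c where "c = T (SOME \<pi>. \<pi> \<in> Priors)"
  have "\<bar>mean \<pi> (\<lambda>_. c) - T \<pi>\<bar> + sd \<pi> (\<lambda>_. c) / sqrt (real n) \<le> d" if \<pi>: "\<pi> \<in> Priors" for \<pi>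
  proof -
    interpret prob_space "bind \<pi> P"
      by (rule prob_space_bind_prior[OF \<pi>])
    have "(SOME \<pi>. \<pi> \<in> Priors) \<in> Priors"
      using \<pi> by (rule someI)
    then have "c = T \<pi>"
      unfolding c_def using \<pi> by (rule eq)
    then show ?thesis
      using d by (simp add: sd_def var_def mean_def prob_space)
  qed
  with const[of c] show ?thesis
    by blast
next
  case False
  with d obtain f where f: "f \<in> F"
    and L: "\<And>\<pi> \<pi>'. \<pi> \<in> Priors \<Longrightarrow> \<pi>' \<in> Priors \<Longrightarrow> lagrangian n (\<pi>, \<pi>') f \<le> 2 * d"
    using lagrangian_uniform[OF top comp contT cont1 cont2 n d(1)] by force
  define A where "A \<pi> = T \<pi> - mean \<pi> f + sd \<pi> f / sqrt (real n)" for \<pi>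
  define B where "B \<pi> = mean \<pi> f - T \<pi> + sd \<pi> f / sqrt (real n)" for \<pi>
  have AB: "A \<pi> \<le> 2 * d - B \<pi>'" if "\<pi> \<in> Priors" "\<pi>' \<in> Priors" for \<pi> \<pi>'
    using L[OF that] by (simp add: A_def B_def lagrangian_def add_divide_distrib)
  have bdd: "bdd_above (A ` Priors)"
    using AB False by (meson bdd_aboveI2 ex_in_conv)
  \<comment> \<open>Shifting by \<open>c\<close> brings the supremum of \<open>A\<close> to exactly
    \<open>d\<close>, and the decoupled bound then forces the shifted \<open>B\<close> below
    \<open>d\<close>.\<close>
  define c where "c = (SUP \<pi>\<in>Priors. A \<pi>) - d"
  have "\<bar>mean \<pi> (\<lambda>x. f x + c) - T \<pi>\<bar> + sd \<pi> (\<lambda>x. f x + c) / sqrt (real n) \<le> d"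
    if \<pi>: "\<pi> \<in> Priors" for \<pi>
  proof -
    have "A \<pi> \<le> (SUP \<pi>\<in>Priors. A \<pi>)"
      using \<pi> bdd by (rule cSUP_upper)
    moreover have "(SUP \<pi>\<in>Priors. A \<pi>) \<le> 2 * d - B \<pi>"
      using False AB[OF _ \<pi>] by (intro cSUP_least) auto
    ultimately show ?thesis
      by (simp add: mean_add_const sd_add_const \<pi> f A_def B_def c_def)
  qed
  moreover have "(\<lambda>x. f x + c) \<in> F"
    using F_lincomb[OF f const[of c], of 1 1] by simp
  ultimately show ?thesis
    by blast
qed

text \<open>The risk is the sum of the squares of the bias and of \<open>sd / sqrt n\<close>, hence
  at most the square of their sum.\<close>

lemma worst_case_risk_linear_le:
  assumes f: "f \<in> F" and n: "n \<ge> 1" and d: "0 \<le> d"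
    and bias: "\<And>\<pi>. \<pi> \<in> Priors \<Longrightarrow> \<bar>mean \<pi> f - T \<pi>\<bar> + sd \<pi> f / sqrt (real n) \<le> d"
  shows "worst_case_risk P Priors T n (\<lambda>x. 1 / real n * (\<Sum>i<n. f (x i))) \<le> (ennreal d)\<^sup>2"
  unfolding worst_case_risk_def
proof (rule SUP_least)
  fix \<pi>
  assume \<pi>: "\<pi> \<in> Priors"
  let ?b = "\<bar>mean \<pi> f - T \<pi>\<bar>" and ?s = "sd \<pi> f / sqrt (real n)"
  have s: "0 \<le> ?s"
    by (simp add: sd_nonneg \<pi> f)
  have "(\<integral>\<^sup>+x. ennreal (\<bar>1 / real n * (\<Sum>i<n. f (x i)) - T \<pi>\<bar>\<^sup>2) \<partial>Pi\<^sub>M {..<n} (\<lambda>_. bind \<pi> P)) =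
      ennreal ((mean \<pi> f - T \<pi>)\<^sup>2 + var \<pi> f / real n)"
    unfolding mean_def var_def
    by (rule nn_integral_empirical_mean_power2)
       (use prob_space_bind_prior F_measurable_bind F_square_integrable \<pi> f n in auto)
  also have "(mean \<pi> f - T \<pi>)\<^sup>2 + var \<pi> f / real n = ?b\<^sup>2 + ?s\<^sup>2"
    by (simp add: power_divide sd_power2 \<pi> f)
  also have "ennreal \<dots> \<le> ennreal ((?b + ?s)\<^sup>2)"
  proof (rule ennreal_leI)
    have "0 \<le> 2 * ?b * ?s"
      by (intro mult_nonneg_nonneg s) auto
    then show "?b\<^sup>2 + ?s\<^sup>2 \<le> (?b + ?s)\<^sup>2"
      unfolding power2_sum by linarith
  qed
  also have "\<dots> \<le> ennreal (d\<^sup>2)"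
    using s bias[OF \<pi>] by (intro ennreal_leI power_mono) auto
  finally show "(\<integral>\<^sup>+x. ennreal (\<bar>1 / real n * (\<Sum>i<n. f (x i)) - T \<pi>\<bar>\<^sup>2) \<partial>Pi\<^sub>M {..<n} (\<lambda>_. bind \<pi> P)) \<le>
      (ennreal d)\<^sup>2"
    using d by (simp add: ennreal_power)
qed

section \<open>The lower bound\<close>

lemma modulus_le_worst_case_risk:
  assumes n: "n \<ge> 1" and f: "f \<in> borel_measurable (Pi\<^sub>M {..<n} (\<lambda>_. N))"
  shows "ennreal (1 / (1 + sqrt (exp 1))\<^sup>2) * (chi2_modulus P Priors T (1 / sqrt (real n)))\<^sup>2
    \<le> worst_case_risk P Priors T n f"
proof (cases "worst_case_risk P Priors T n f")
  case top
  then show ?thesis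
    by simp
next
  case (real c)
  define R where "R = sqrt c"
  have R: "0 \<le> R" "worst_case_risk P Priors T n f = ennreal (R\<^sup>2)"
    using real by (auto simp: R_def)
  let ?K = "1 + sqrt (exp 1)"
  have K: "0 < ?K"
    by (simp add: add_pos_nonneg)
  have risk: "(\<integral>\<^sup>+x. ennreal (\<bar>f x - T \<pi>\<bar>\<^sup>2) \<partial>Pi\<^sub>M {..<n} (\<lambda>_. bind \<pi> P)) \<le> ennreal (R\<^sup>2)"
    if "\<pi> \<in> Priors" for \<pi>
    unfolding R(2)[symmetric] worst_case_risk_def using that by (rule SUP_upper)
  have "chi2_modulus P Priors T (1 / sqrt (real n)) \<le> ennreal (?K * R)"
    unfolding chi2_modulus_def
  proof (rule Sup_least, safe)
    fix \<pi> \<pi>'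
    assume \<pi>: "\<pi> \<in> Priors" and \<pi>': "\<pi>' \<in> Priors"
      and chi2: "chi2_divergence (bind \<pi>' P) (bind \<pi> P) \<le> ennreal ((1 / sqrt (real n))\<^sup>2)"
    have "chi2_divergence (bind \<pi>' P) (bind \<pi> P) \<le> ennreal (1 / real n)"
      using chi2 by (simp add: power_divide)
    note * = nn_integral_RN_deriv_power2_le[OF this]
    have "\<bar>T \<pi>' - T \<pi>\<bar> \<le> ?K * R"
    proof (rule two_point_lower_bound)
      show "f \<in> borel_measurable (Pi\<^sub>M {..<n} (\<lambda>_. bind \<pi> P))"
        using f sets_PiM_cong[of "{..<n}" "{..<n}" "\<lambda>_. bind \<pi> P" "\<lambda>_. N"] sets_bind_prior[OF \<pi>]
        by (simp cong: measurable_cong_sets)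
    qed (use * R(1) n risk \<pi> \<pi>' in \<open>auto simp: prob_space_bind_prior sets_bind_prior\<close>)
    then show "ennreal (T \<pi>' - T \<pi>) \<le> ennreal (?K * R)"
      by (intro ennreal_leI) simp
  qed
  then have "ennreal (1 / ?K\<^sup>2) * (chi2_modulus P Priors T (1 / sqrt (real n)))\<^sup>2
      \<le> ennreal (1 / ?K\<^sup>2) * (ennreal (?K * R))\<^sup>2"
    by (intro mult_left_mono power_mono_ennreal) auto
  also have "\<dots> = ennreal (1 / ?K\<^sup>2 * (?K * R)\<^sup>2)"
    using K R by (subst ennreal_power) (auto simp flip: ennreal_mult)
  also have "1 / ?K\<^sup>2 * (?K * R)\<^sup>2 = R\<^sup>2"
    using K by (simp add: power_mult_distrib)
  finally show ?thesis
    by (simp add: R)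
qed

end

section \<open>Combination of the lower bound with the linear estimator\<close>

theorem theorem1:
  fixes M :: "'a measure" and N :: "'b measure"
    and P :: "'a \<Rightarrow> 'b measure"
    and Priors :: "'a measure set"
    and T :: "'a measure \<Rightarrow> real"
    and F :: "('b \<Rightarrow> real) set"
    and n :: nat
  assumes kernel: "P \<in> M \<rightarrow>\<^sub>M prob_algebra N"
    and priors: "Priors \<subseteq> space (prob_algebra M)"
    and A1: "affine_functional Priors T"
    and A2: "convex_measures Priors"
    and A3: "function_space F" "\<And>c. (\<lambda>_. c) \<in> F" "\<And>\<pi>. \<pi> \<in> Priors \<Longrightarrow> dense_in_L2 F (bind \<pi> P)"
    and A4: "\<exists>\<tau>. topspace \<tau> = Priors \<and> compact_space \<tau> \<and>
               continuous_map \<tau> euclideanreal T \<and>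
               (\<forall>f\<in>F. continuous_map \<tau> euclideanreal (\<lambda>\<pi>. \<integral>x. f x \<partial>(bind \<pi> P)) \<and>
                      continuous_map \<tau> euclideanreal (\<lambda>\<pi>. \<integral>x. (f x)\<^sup>2 \<partial>(bind \<pi> P)))"
    and n: "n \<ge> 1"
  shows "ennreal (1 / (1 + sqrt (exp 1))\<^sup>2) * (chi2_modulus P Priors T (1 / sqrt (real n)))\<^sup>2
           \<le> minimax_risk N P Priors T n
       \<and> minimax_risk N P Priors T n \<le> (chi2_modulus P Priors T (1 / sqrt (real n)))\<^sup>2
       \<and> (\<exists>g\<in>F. worst_case_risk P Priors T n (\<lambda>x. 1 / real n * (\<Sum>i<n. g (x i)))
                 \<le> (chi2_modulus P Priors T (1 / sqrt (real n)))\<^sup>2)"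
proof -
  interpret mixture_model M N P Priors T F
    by standard (use assms in auto)
  let ?\<delta> = "chi2_modulus P Priors T (1 / sqrt (real n))"
  have lower: "ennreal (1 / (1 + sqrt (exp 1))\<^sup>2) * ?\<delta>\<^sup>2 \<le> minimax_risk N P Priors T n"
    unfolding minimax_risk_def using n by (intro INF_greatest modulus_le_worst_case_risk)
  obtain \<tau> where \<tau>: "topspace \<tau> = Priors" "compact_space \<tau>" "continuous_map \<tau> euclideanreal T"
    "\<And>f. f \<in> F \<Longrightarrow> continuous_map \<tau> euclideanreal (\<lambda>\<pi>. mean \<pi> f)"
    "\<And>f. f \<in> F \<Longrightarrow> continuous_map \<tau> euclideanreal (\<lambda>\<pi>. mean \<pi> (\<lambda>x. (f x)\<^sup>2))"
    using A4 unfolding mean_def by blast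
  have "\<exists>g\<in>F. worst_case_risk P Priors T n (\<lambda>x. 1 / real n * (\<Sum>i<n. g (x i))) \<le> ?\<delta>\<^sup>2"
  proof (cases ?\<delta>)
    case (real d)
    with linear_estimator[OF \<tau> n] worst_case_risk_linear_le[OF _ n] show ?thesis
      by metis
  next
    \<comment> \<open>An infinite modulus bounds the risk of any estimator, so the zero function
      will do.\<close>
    case top
    with const[of 0] show ?thesis
      by (auto simp: power2_eq_square)
  qed
  then obtain g where g: "g \<in> F"
    and le: "worst_case_risk P Priors T n (\<lambda>x. 1 / real n * (\<Sum>i<n. g (x i))) \<le> ?\<delta>\<^sup>2"
    by blast
  have "minimax_risk N P Priors T n \<le> ?\<delta>\<^sup>2"
  \<comment> \<open>Measurability of \<open>g\<close> on \<open>N\<close> is derived from the law of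
    some prior. If there is none, the zero estimator has risk 0, the supremum of the empty
    set.\<close>
  proof (cases "Priors = {}")
    case True
    then have "worst_case_risk P Priors T n (\<lambda>_. 0) = 0"
      by (simp add: worst_case_risk_def bot_ennreal)
    then have "minimax_risk N P Priors T n \<le> 0"
      unfolding minimax_risk_def by (intro INF_lower2[of "\<lambda>_. 0"]) auto
    then show ?thesis
      by simp
  next
    case False
    then have [measurable]: "g \<in> borel_measurable N"
      using F_measurable g by auto
    have "(\<lambda>x. 1 / real n * (\<Sum>i<n. g (x i))) \<in> borel_measurable (Pi\<^sub>M {..<n} (\<lambda>_. N))"
      by measurable
    with le show ?thesis
      unfolding minimax_risk_def by (blast intro: INF_lower2)
  qed
  with lower g le show ?thesis
    by blast
qed

end
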